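(* Let $X$ and $Y$ be real Banach spaces, let $x\in S_X$ and $y\in S_Y$ be relative Daugavet-points (of $X$ and $Y$ respectively), let $N$ be an absolute normalized norm on $\mathbb{R}^2$, and let $a,b\ge 0$ be such that $N(a,b)=1$. Then $(ax,by)$ is a relative Daugavet-point of $X\oplus_N Y$ if and only if $(a,b)$ is a convex combination of two (not necessarily distinct) v-points of $(\mathbb{R}^2,N)$.
   Context: All Banach spaces are real. For a Banach space $Z$, $B_Z$ and $S_Z$ denote its closed unit ball and unit sphere. A slice of $B_Z$ is a set of the form $S(z^*,\alpha)=\{w\in B_Z:\ z^*(w)>\sup z^*(B_Z)-\alpha\}$ with $z^*\in Z^*$ and $\alpha>0$. For $z\in S_Z$ let $D(z)=\{z^*\in S_{Z^*}:\ z^*(z)=1\}$; a supporting slice at $z$ is a slice $S(z^*,\alpha)$ with $z^*\in D(z)$ and $\alpha>0$. A point $z\in S_Z$ is a Daugavet-point relative to a supporting slice $S$ at $z$ if $\sup_{w\in T}\|z-w\|=2$ for every slice $T$ of $B_Z$ with $T\subseteq S$. A point $z\in S_Z$ is a relative Daugavet-point if it is a Daugavet-point relative to some supporting slice at $z$. A norm $N$ on $\mathbb{R}^2$ is absolute if $N(a,b)=N(|a|,|b|)$ for all $(a,b)$, and normalized if $N(1,0)=N(0,1)=1$. For such $N$, $X\oplus_N Y$ is $X\times Y$ with the norm $\|(x,y)\|_N=N(\|x\|,\|y\|)$. Let $E=(\mathbb{R}^2,\|\cdot\|)$ be a two-dimensional Banach space. A point $e\in S_E$ is a v-point (vertex-point)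 of $E$ if there exist $u,v\in S_E$ such that $\|e+u\|=\|e+v\|=2$ and $\|u+v\|<2$. *)

theory Defs
  imports "HOL-Analysis.Analysis"
begin

text \<open>
  The class norm of a product type is the Euclidean one, and the norm of
  $X \oplus_N Y$ depends on the term $N$.  Hence the geometric notions take the norm as an explicit
  argument \<open>nrm\<close> on a real vector space; for a Banach space given by a type they are used
  at \<open>nrm = norm\<close>.
\<close>

definition is_norm :: "('z::real_vector \<Rightarrow> real) \<Rightarrow> bool" where
  "is_norm nrm \<longleftrightarrow>
     (\<forall>v. 0 \<le> nrm v) \<and>
     (\<forall>v. nrm v = 0 \<longleftrightarrow> v = 0) \<and>
     (\<forall>c v. nrm (c *\<^sub>R v) = \<bar>c\<bar> * nrm v) \<and>
     (\<forall>v w. nrm (v + w) \<le> nrm v + nrm w)"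

definition unit_ball :: "('z::real_vector \<Rightarrow> real) \<Rightarrow> 'z set" where
  "unit_ball nrm = {v. nrm v \<le> 1}"

definition unit_sphere :: "('z::real_vector \<Rightarrow> real) \<Rightarrow> 'z set" where
  "unit_sphere nrm = {v. nrm v = 1}"

definition dual_space :: "('z::real_vector \<Rightarrow> real) \<Rightarrow> ('z \<Rightarrow> real) set" where
  "dual_space nrm = {f. linear f \<and> (\<exists>K. \<forall>v. \<bar>f v\<bar> \<le> K * nrm v)}"

definition dual_norm :: "('z::real_vector \<Rightarrow> real) \<Rightarrow> ('z \<Rightarrow> real) \<Rightarrow> real" where
  "dual_norm nrm f = (SUP v\<in>unit_ball nrm. \<bar>f v\<bar>)"

definition slice :: "('z::real_vector \<Rightarrow> real) \<Rightarrow> ('z \<Rightarrow> real) \<Rightarrow> real \<Rightarrow> 'z set" where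
  "slice nrm f \<alpha> = {w \<in> unit_ball nrm. f w > (SUP v\<in>unit_ball nrm. f v) - \<alpha>}"

definition is_slice :: "('z::real_vector \<Rightarrow> real) \<Rightarrow> 'z set \<Rightarrow> bool" where
  "is_slice nrm S \<longleftrightarrow> (\<exists>f\<in>dual_space nrm. \<exists>\<alpha>>0. S = slice nrm f \<alpha>)"

definition supporting_functionals :: "('z::real_vector \<Rightarrow> real) \<Rightarrow> 'z \<Rightarrow> ('z \<Rightarrow> real) set" where
  "supporting_functionals nrm z = {f \<in> dual_space nrm. dual_norm nrm f = 1 \<and> f z = 1}"

definition supporting_slice :: "('z::real_vector \<Rightarrow> real) \<Rightarrow> 'z \<Rightarrow> 'z set \<Rightarrow> bool" where
  "supporting_slice nrm z S \<longleftrightarrow> (\<exists>f\<in>supporting_functionals nrm z. \<exists>\<alpha>>0. S = slice nrm f \<alpha>)"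

definition Daugavet_point_relative_to :: "('z::real_vector \<Rightarrow> real) \<Rightarrow> 'z \<Rightarrow> 'z set \<Rightarrow> bool" where
  "Daugavet_point_relative_to nrm z S \<longleftrightarrow>
     z \<in> unit_sphere nrm \<and> supporting_slice nrm z S \<and>
     (\<forall>T. is_slice nrm T \<and> T \<subseteq> S \<longrightarrow> (SUP w\<in>T. nrm (z - w)) = 2)"

definition relative_Daugavet_point :: "('z::real_vector \<Rightarrow> real) \<Rightarrow> 'z \<Rightarrow> bool" where
  "relative_Daugavet_point nrm z \<longleftrightarrow> (\<exists>S. Daugavet_point_relative_to nrm z S)"

definition absolute_norm :: "(real \<times> real \<Rightarrow> real) \<Rightarrow> bool" where
  "absolute_norm N \<longleftrightarrow> is_norm N \<and> (\<forall>a b. N (a, b) = N (\<bar>a\<bar>, \<bar>b\<bar>))"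

definition normalized_norm :: "(real \<times> real \<Rightarrow> real) \<Rightarrow> bool" where
  "normalized_norm N \<longleftrightarrow> is_norm N \<and> N (1, 0) = 1 \<and> N (0, 1) = 1"

definition sum_norm ::
  "(real \<times> real \<Rightarrow> real) \<Rightarrow> 'a::real_normed_vector \<times> 'b::real_normed_vector \<Rightarrow> real" where
  "sum_norm N = (\<lambda>(x, y). N (norm x, norm y))"

definition v_point :: "(real \<times> real \<Rightarrow> real) \<Rightarrow> real \<times> real \<Rightarrow> bool" where
  "v_point N e \<longleftrightarrow>
     e \<in> unit_sphere N \<and>
     (\<exists>u\<in>unit_sphere N. \<exists>v\<in>unit_sphere N. N (e + u) = 2 \<and> N (e + v) = 2 \<and> N (u + v) < 2)"

text \<open>At \<open>nrm = norm\<close> these are the library notions.\<close>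

lemma is_norm_norm: "is_norm (norm :: 'a::real_normed_vector \<Rightarrow> real)"
  by (simp add: is_norm_def norm_triangle_ineq)

lemma unit_ball_norm: "unit_ball norm = cball 0 1"
  by (auto simp: unit_ball_def)

lemma unit_sphere_norm: "unit_sphere norm = sphere 0 1"
  by (auto simp: unit_sphere_def)

lemma dual_space_norm: "dual_space norm = {f. bounded_linear f}"
  by (auto simp: dual_space_def bounded_linear_def bounded_linear_axioms_def mult.commute)

lemma dual_norm_norm:
  fixes f :: "'a::real_normed_vector \<Rightarrow> real"
  assumes "bounded_linear f"
  shows "dual_norm norm f = onorm f"
  unfolding dual_norm_def
proof (rule cSup_eq_non_empty)
  show "(\<lambda>v. \<bar>f v\<bar>) ` unit_ball norm \<noteq> {}"
    by (auto simp: unit_ball_def intro: exI[of _ 0])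
next
  fix r assume "r \<in> (\<lambda>v. \<bar>f v\<bar>) ` unit_ball norm"
  then obtain v where v: "norm v \<le> 1" "r = \<bar>f v\<bar>"
    by (auto simp: unit_ball_def)
  have "norm (f v) \<le> onorm f * norm v"
    by (rule onorm[OF assms])
  also have "\<dots> \<le> onorm f * 1"
    using v(1) onorm_pos_le[OF assms] by (rule mult_left_mono)
  finally show "r \<le> onorm f"
    using v(2) by simp
next
  fix r assume r: "\<And>s. s \<in> (\<lambda>v. \<bar>f v\<bar>) ` unit_ball norm \<Longrightarrow> s \<le> r"
  interpret f: bounded_linear f by (rule assms)
  show "onorm f \<le> r"
    unfolding onorm_def
  proof (rule cSUP_least)
    fix v :: 'a
    have "\<bar>f ((1 / norm v) *\<^sub>R v)\<bar> \<le> r"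
      by (rule r) (auto simp: unit_ball_def)
    then show "norm (f v) / norm v \<le> r"
      by (simp add: f.scaleR abs_mult)
  qed simp
qed

end

theory Submission
  imports Defs
begin

text \<open>
  Slices of \<open>X \<oplus> Y\<close> are compared with slices of the plane \<open>E = (\<real>\<^sup>2, N)\<close>.  Write \<open>e = (a, b)\<close>, and let
  \<open>S(h, \<alpha>)\<close> be the slice of the unit ball of \<open>E\<close> on which a functional \<open>h\<close> of norm 1 exceeds
  \<open>1 - \<alpha>\<close>.  Recall that \<open>N (u + v) = 2\<close> for two unit vectors of \<open>E\<close> means that the segment
  between them lies on the sphere, equivalently that one functional of norm 1 is 1 at both.  So a
  v-point is a corner of the sphere at which two proper segments meet.

  Suppose that \<open>(ax, by)\<close> is a relative Daugavet-point, with the slice given by \<open>F = (f, g)\<close> and \<open>\<alpha>\<close>.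
  Then \<open>h = (\<parallel>f\<parallel>, \<parallel>g\<parallel>)\<close> has norm 1 and \<open>h(e) = 1\<close>.  Let \<open>(m, n)\<close> have norm 1 and coordinates at
  least 0, and suppose that its face lies in \<open>S(h, \<alpha>)\<close>.  Rescaling \<open>f\<close> to norm \<open>m\<close> and \<open>g\<close> to norm
  \<open>n\<close> gives a functional on the sum with a slice inside that of \<open>F\<close>.  The points \<open>(w, v)\<close> of this
  slice have \<open>(\<parallel>w\<parallel>, \<parallel>v\<parallel>)\<close> close to the face of \<open>(m, n)\<close>, and their distance from \<open>(ax, by)\<close> is at
  most \<open>N (e + (\<parallel>w\<parallel>, \<parallel>v\<parallel>))\<close>.  Hence the face contains a point \<open>w\<close> with \<open>N (e + w) = 2\<close>
  (\<open>positively_Daugavet_if_sum\<close>).  This forces a segment on the sphere of \<open>E\<close> next to each end \<open>q\<close>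
  of the face of \<open>h\<close>, outside that face: otherwise there are faces arbitrarily close to \<open>q\<close> that
  miss \<open>q\<close>, and a point \<open>w\<close> of such a face with \<open>N (e + w) = 2\<close> yields a segment from \<open>e\<close> across
  \<open>q\<close> to \<open>w\<close> (\<open>edge_beyond_face\<close>, \<open>flat_edge_after_face\<close>).  So both ends of the face of \<open>h\<close>, a
  segment which contains \<open>e\<close>, are v-points.

  Conversely, let \<open>e\<close> be on a segment between two v-points.  There is a functional \<open>h\<close> whose face is
  that segment, or just \<open>e\<close> if \<open>e\<close> itself is a v-point.  Near this face the ball is a polygon, so
  every functional that is maximal only inside a small slice of \<open>h\<close> is maximal at one of finitely
  many points of the face (\<open>positive_slice_from_v_points\<close>).  Put \<open>F = (c f, d g)\<close>, where
  \<open>h = (c, d)\<close> and \<open>f\<close>, \<open>g\<close> are the functionals that belong to \<open>x\<close> and \<open>y\<close>.  A slice inside the one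
  of \<open>F\<close>, given by \<open>(\<phi>, \<psi>)\<close>, then contains points \<open>(s w, t v)\<close> with \<open>(s, t)\<close> on the face of \<open>h\<close> and
  with \<open>w\<close> and \<open>v\<close> free in small slices of \<open>\<phi>\<close> and \<open>\<psi>\<close>.  Wherever it matters, these lie in the
  slices that belong to \<open>x\<close> and \<open>y\<close>, so \<open>w\<close> and \<open>v\<close> can be taken almost at distance 2 from \<open>x\<close> and
  \<open>y\<close>.  The norm of \<open>(ax - s w, by - t v)\<close> is then almost
  \<open>c (a + s) + d (b + t) = h(e) + h(s, t) = 2\<close> (\<open>relative_Daugavet_point_sumI\<close>).
\<close>

section \<open>Norming functionals and v-points\<close>

lemma is_norm_nonneg: "is_norm N \<Longrightarrow> 0 \<le> N v"
  and is_norm_zero: "is_norm N \<Longrightarrow> N 0 = 0"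
  and is_norm_pos: "is_norm N \<Longrightarrow> v \<noteq> 0 \<Longrightarrow> 0 < N v"
  and is_norm_scaleR: "is_norm N \<Longrightarrow> N (c *\<^sub>R v) = \<bar>c\<bar> * N v"
  and is_norm_triangle: "is_norm N \<Longrightarrow> N (v + w) \<le> N v + N w"
  by (auto simp: is_norm_def order_less_le)

lemma is_norm_minus: "is_norm N \<Longrightarrow> N (- v) = N v"
  using is_norm_scaleR[of N "-1" v] by simp

lemma is_norm_convex_on:
  assumes N: "is_norm N"
  shows "convex_on UNIV N"
proof (rule convex_onI)
  fix t :: real and x y assume "0 < t" "t < 1"
  then show "N ((1 - t) *\<^sub>R x + t *\<^sub>R y) \<le> (1 - t) * N x + t * N y"
    using is_norm_triangle[OF N, of "(1 - t) *\<^sub>R x" "t *\<^sub>R y"] by (simp add: is_norm_scaleR[OF N])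
qed simp

lemma is_norm_continuous_on:
  fixes N :: "'e::euclidean_space \<Rightarrow> real"
  assumes "is_norm N"
  shows "continuous_on S N"
  using convex_on_continuous[OF open_UNIV is_norm_convex_on[OF assms]]
  by (rule continuous_on_subset) simp

text \<open>
  On a Euclidean space a functional is represented by a vector, through the inner product; for a
  norm \<open>N\<close>, being subordinate to \<open>N\<close> is having dual norm at most 1.
\<close>

definition subordinate :: "('e::real_inner \<Rightarrow> real) \<Rightarrow> 'e \<Rightarrow> bool" where
  "subordinate N G \<longleftrightarrow> (\<forall>w. G \<bullet> w \<le> N w)"

text \<open>For a subordinate \<open>G\<close> this is the face on which \<open>G\<close> norms; it is empty if \<open>G\<close> has norm below 1.\<close>

definition exposed_face :: "('e::real_inner \<Rightarrow> real) \<Rightarrow> 'e \<Rightarrow> 'e set" where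
  "exposed_face N G = {w \<in> unit_ball N. G \<bullet> w = 1}"

lemma subordinateD: "subordinate N G \<Longrightarrow> G \<bullet> w \<le> N w"
  by (simp add: subordinate_def)

lemma exposed_face_norm: "subordinate N G \<Longrightarrow> w \<in> exposed_face N G \<Longrightarrow> N w = 1"
  using subordinateD[of N G w] by (simp add: exposed_face_def unit_ball_def)

text \<open>
  Hahn-Banach in finite dimension: a hyperplane separates \<open>u\<close> from the open ball of radius \<open>N u\<close>.
\<close>

lemma norming_functional_exists:
  fixes N :: "'e::euclidean_space \<Rightarrow> real"
  assumes N: "is_norm N"
  obtains G where "subordinate N G" "G \<bullet> u = N u"
proof (cases "u = 0")
  case True
  then show ?thesis
    using that[of 0] is_norm_nonneg[OF N] is_norm_zero[OF N] by (auto simp: subordinate_def)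
next
  case False
  then have pos: "0 < N u" by (rule is_norm_pos[OF N])
  let ?S = "{w. N w < N u}"
  have "convex ?S"
  proof (rule convexI)
    fix x y and s t :: real assume "x \<in> ?S" "y \<in> ?S" "0 \<le> s" "0 \<le> t" "s + t = 1"
    then have "s * N x + t * N y < N u" by (intro convex_bound_lt) auto
    then show "s *\<^sub>R x + t *\<^sub>R y \<in> ?S"
      using is_norm_triangle[OF N, of "s *\<^sub>R x" "t *\<^sub>R y"] \<open>0 \<le> s\<close> \<open>0 \<le> t\<close>
      by (simp add: is_norm_scaleR[OF N])
  qed
  moreover have "?S \<noteq> {}" using pos is_norm_zero[OF N] by (auto intro: exI[of _ 0])
  ultimately obtain A t where A: "A \<noteq> 0" "\<And>w. N w < N u \<Longrightarrow> A \<bullet> w \<le> t" "t \<le> A \<bullet> u"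
    using separating_hyperplane_sets[of ?S "{u}"] by auto
  define k where "k = N u / (2 * N A)"
  have NA: "0 < N A" by (rule is_norm_pos[OF N A(1)])
  have "N (k *\<^sub>R A) < N u"
    using NA pos by (simp add: is_norm_scaleR[OF N] k_def)
  then have "k * (A \<bullet> A) \<le> A \<bullet> u" using A(2,3) by fastforce
  moreover have "0 < k * (A \<bullet> A)" using NA pos A(1) by (simp add: k_def)
  ultimately have Au: "0 < A \<bullet> u" by linarith
  have main: "A \<bullet> w * N u \<le> N w * (A \<bullet> u)" for w
  proof (rule field_le_epsilon)
    fix \<epsilon> :: real assume "0 < \<epsilon>"
    define r where "r = N w + \<epsilon> / (A \<bullet> u)"
    have r: "N w < r" using \<open>0 < \<epsilon>\<close> Au by (simp add: r_def)
    with is_norm_nonneg[OF N, of w] have "0 < r" by linarith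
    have "N ((N u / r) *\<^sub>R w) < N u"
      using r \<open>0 < r\<close> pos by (simp add: is_norm_scaleR[OF N] field_simps)
    then have "A \<bullet> ((N u / r) *\<^sub>R w) \<le> A \<bullet> u" using A(2,3) by fastforce
    then have "A \<bullet> w * N u \<le> r * (A \<bullet> u)" using \<open>0 < r\<close> by (simp add: field_simps)
    also have "\<dots> = N w * (A \<bullet> u) + \<epsilon>" using Au by (simp add: r_def field_simps)
    finally show "A \<bullet> w * N u \<le> N w * (A \<bullet> u) + \<epsilon>" .
  qed
  show ?thesis
  proof
    show "subordinate N ((N u / (A \<bullet> u)) *\<^sub>R A)"
      using main Au by (simp add: subordinate_def field_simps)
    show "((N u / (A \<bullet> u)) *\<^sub>R A) \<bullet> u = N u" using Au by simp
  qed
qed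

text \<open>
  A functional that norms \<open>u + v\<close> has to norm both summands.  All statements about segments on the
  sphere are used in this form, since functionals can be evaluated on linear combinations.
\<close>

lemma common_norming_functional:
  fixes N :: "'e::euclidean_space \<Rightarrow> real"
  assumes N: "is_norm N" and "N (u + v) = N u + N v"
  obtains G where "subordinate N G" "G \<bullet> u = N u" "G \<bullet> v = N v"
proof -
  obtain G where G: "subordinate N G" "G \<bullet> (u + v) = N (u + v)"
    using norming_functional_exists[OF N] by blast
  moreover have "G \<bullet> u \<le> N u" "G \<bullet> v \<le> N v" using subordinateD[OF G(1)] by auto
  ultimately show ?thesis using that assms(2) by (simp add: inner_add_right)
qed

lemma norm_add_eq_if_common_functional:
  assumes N: "is_norm N" and G: "subordinate N G" and "G \<bullet> u = N u" "G \<bullet> v = N v"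
  shows "N (u + v) = N u + N v"
  using subordinateD[OF G, of "u + v"] is_norm_triangle[OF N, of u v] assms(3,4)
  by (simp add: inner_add_right)

lemma norming_functional_cone:
  assumes N: "is_norm N" and G: "subordinate N G" "G \<bullet> u = N u"
    and "G \<bullet> v = N v" "0 \<le> \<mu>" "0 \<le> \<nu>"
  shows "G \<bullet> (\<mu> *\<^sub>R u + \<nu> *\<^sub>R v) = N (\<mu> *\<^sub>R u + \<nu> *\<^sub>R v)"
proof -
  have "N (\<mu> *\<^sub>R u + \<nu> *\<^sub>R v) \<le> \<mu> * N u + \<nu> * N v"
    using is_norm_triangle[OF N, of "\<mu> *\<^sub>R u" "\<nu> *\<^sub>R v"] assms by (simp add: is_norm_scaleR[OF N])
  also have "\<dots> = G \<bullet> (\<mu> *\<^sub>R u + \<nu> *\<^sub>R v)"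
    using assms by (simp add: inner_add_right)
  finally show ?thesis using subordinateD[OF G(1)] by (meson order_antisym)
qed

text \<open>
  The two segments that meet at a v-point lie on different supporting lines.
\<close>

lemma v_pointE:
  assumes N: "is_norm N" and "v_point N e"
  obtains u v G H where "N e = 1" "N u = 1" "N v = 1"
    "subordinate N G" "G \<bullet> e = 1" "G \<bullet> u = 1" "G \<bullet> v < 1"
    "subordinate N H" "H \<bullet> e = 1" "H \<bullet> v = 1" "H \<bullet> u < 1"
proof -
  obtain u v where e: "N e = 1" and u: "N u = 1" "N (e + u) = 2" and v: "N v = 1" "N (e + v) = 2"
    and uv: "N (u + v) < 2"
    using assms(2) by (auto simp: v_point_def unit_sphere_def)
  obtain G where G: "subordinate N G" "G \<bullet> e = 1" "G \<bullet> u = 1"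
    using common_norming_functional[OF N, of e u] e u by auto
  obtain H where H: "subordinate N H" "H \<bullet> e = 1" "H \<bullet> v = 1"
    using common_norming_functional[OF N, of e v] e v by auto
  have "G \<bullet> v < 1" "H \<bullet> u < 1"
    using subordinateD[OF G(1), of "u + v"] subordinateD[OF H(1), of "u + v"] G H uv
    by (auto simp: inner_add_right)
  then show ?thesis using that e u v G H by blast
qed

text \<open>
  The two directions \<open>e + s \<tau>\<close> and \<open>e - t \<tau>\<close> lie on either side of \<open>e\<close> on a line through it, and
  each is joined to \<open>e\<close> by a segment of the sphere.  The last hypothesis says that \<open>N\<close> is not affine
  across \<open>e\<close> on that line, so the two segments do not belong to one face.
\<close>

lemma v_pointI:
  assumes N: "is_norm N" and e: "N e = 1" and s: "0 < s" and t: "0 < t"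
    and pos: "0 < N (e + s *\<^sub>R \<tau>)" "0 < N (e - t *\<^sub>R \<tau>)"
    and G: "subordinate N G" "G \<bullet> e = 1" "G \<bullet> (e + s *\<^sub>R \<tau>) = N (e + s *\<^sub>R \<tau>)"
    and H: "subordinate N H" "H \<bullet> e = 1" "H \<bullet> (e - t *\<^sub>R \<tau>) = N (e - t *\<^sub>R \<tau>)"
    and kink: "s + t < t * N (e + s *\<^sub>R \<tau>) + s * N (e - t *\<^sub>R \<tau>)"
  shows "v_point N e"
proof -
  define u where "u = (1 / N (e + s *\<^sub>R \<tau>)) *\<^sub>R (e + s *\<^sub>R \<tau>)"
  define v where "v = (1 / N (e - t *\<^sub>R \<tau>)) *\<^sub>R (e - t *\<^sub>R \<tau>)"
  have u: "N u = 1" "G \<bullet> u = 1" using pos G by (simp_all add: u_def is_norm_scaleR[OF N])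
  have v: "N v = 1" "H \<bullet> v = 1" using pos H by (simp_all add: v_def is_norm_scaleR[OF N])
  have "N (e + u) = 2" "N (e + v) = 2"
    using norm_add_eq_if_common_functional[OF N G(1), of e u]
      norm_add_eq_if_common_functional[OF N H(1), of e v] e u v G H by auto
  moreover have "N (u + v) \<noteq> 2"
  proof
    assume "N (u + v) = 2"
    then obtain L where L: "subordinate N L" "L \<bullet> u = 1" "L \<bullet> v = 1"
      using common_norming_functional[OF N, of u v] u v by auto
    have "L \<bullet> (e + s *\<^sub>R \<tau>) = N (e + s *\<^sub>R \<tau>)" "L \<bullet> (e - t *\<^sub>R \<tau>) = N (e - t *\<^sub>R \<tau>)"
      using L pos unfolding u_def v_def inner_scaleR_right by simp_all
    then have "t * N (e + s *\<^sub>R \<tau>) + s * N (e - t *\<^sub>R \<tau>)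
        = t * (L \<bullet> (e + s *\<^sub>R \<tau>)) + s * (L \<bullet> (e - t *\<^sub>R \<tau>))" by simp
    also have "\<dots> = (s + t) * (L \<bullet> e)"
      by (simp add: inner_add_right inner_diff_right algebra_simps)
    also have "\<dots> \<le> (s + t) * 1"
      using subordinateD[OF L(1), of e] e s t by (intro mult_left_mono) auto
    finally show False using kink by simp
  qed
  moreover have "N (u + v) \<le> 2" using is_norm_triangle[OF N, of u v] u v by simp
  ultimately have "N (e + u) = 2" "N (e + v) = 2" "N (u + v) < 2" by linarith+
  then show ?thesis using e u(1) v(1) unfolding v_point_def unit_sphere_def by blast
qed

section \<open>Slices of the plane near a segment of v-points\<close>

lemma triangle_with_origin:
  assumes "w = \<mu> *\<^sub>R p + \<nu> *\<^sub>R u" "0 \<le> \<mu>" "0 \<le> \<nu>" "\<mu> + \<nu> \<le> 1"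
  shows "w \<in> convex hull {0, p, u}"
  unfolding convex_hull_3 using assms
  by (intro CollectI exI[of _ "1 - \<mu> - \<nu>"] exI[of _ \<mu>] exI[of _ \<nu>]) simp

text \<open>
  Let \<open>[p, u]\<close> be a segment of the sphere.  The half plane on the side of \<open>u\<close> of the line through 0
  and \<open>p\<close> consists of the cone over the segment, where the ball is just the triangle with vertices
  0, \<open>p\<close>, \<open>u\<close>, and of points beyond \<open>u\<close>; a functional that norms \<open>p\<close> does not exceed there, on the
  ball, the larger of its values at \<open>u\<close> and 0.
\<close>

lemma edge_or_outside_slice:
  fixes p u :: "'e::real_inner"
  assumes N: "is_norm N" and G: "subordinate N G" "G \<bullet> p = 1" "G \<bullet> u = 1"
    and h: "subordinate N h" "h \<bullet> p = 1" and "N p = 1" "N u = 1"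
    and w: "w = \<mu> *\<^sub>R p + \<nu> *\<^sub>R u" "0 \<le> \<nu>" "N w \<le> 1"
  shows "w \<in> convex hull {0, p, u} \<or> h \<bullet> w \<le> max 0 (h \<bullet> u)"
proof (cases "0 \<le> \<mu>")
  case True
  have "\<mu> + \<nu> \<le> 1"
    using subordinateD[OF G(1), of w] w G by (simp add: inner_add_right)
  then have "w \<in> convex hull {0, p, u}"
    using triangle_with_origin w True by blast
  then show ?thesis ..
next
  case False
  have "\<nu> = N (\<nu> *\<^sub>R u)" using assms by (simp add: is_norm_scaleR[OF N])
  also have "\<nu> *\<^sub>R u = w + (- \<mu>) *\<^sub>R p" using w by simp
  also have "N (w + (- \<mu>) *\<^sub>R p) \<le> 1 - \<mu>"
    using is_norm_triangle[OF N, of w "(- \<mu>) *\<^sub>R p"] is_norm_scaleR[OF N, of "- \<mu>" p] assms False by simp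
  finally have \<nu>: "\<nu> \<le> 1 - \<mu>" .
  have hw: "h \<bullet> w = \<mu> + \<nu> * (h \<bullet> u)" using w h by (simp add: inner_add_right)
  have hu: "h \<bullet> u \<le> 1" using subordinateD[OF h(1), of u] assms by simp
  show ?thesis
  proof (cases "0 \<le> h \<bullet> u")
    case True
    have "\<mu> + \<nu> * (h \<bullet> u) \<le> \<mu> + (1 - \<mu>) * (h \<bullet> u)"
      using \<nu> True by (simp add: mult_right_mono)
    also have "\<dots> = h \<bullet> u + \<mu> * (1 - h \<bullet> u)" by algebra
    also have "\<dots> \<le> h \<bullet> u" using False hu by (simp add: mult_nonpos_nonneg)
    finally have "h \<bullet> w \<le> h \<bullet> u" using hw by simp
    then show ?thesis by linarith
  next
    case neg: False
    have "\<nu> * (h \<bullet> u) \<le> 0" using neg w by (simp add: mult_nonneg_nonpos)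
    then have "h \<bullet> w \<le> 0" using hw False by linarith
    then show ?thesis by linarith
  qed
qed

lemma plane_basis:
  fixes p q w :: "real \<times> real"
  assumes "fst p * snd q \<noteq> snd p * fst q"
  obtains \<mu> \<nu> where "w = \<mu> *\<^sub>R p + \<nu> *\<^sub>R q"
proof -
  let ?D = "fst p * snd q - snd p * fst q"
  have "w = ((fst w * snd q - snd w * fst q) / ?D) *\<^sub>R p + ((fst p * snd w - snd p * fst w) / ?D) *\<^sub>R q"
    using assms
    by (auto simp: prod_eq_iff add_divide_distrib[symmetric] nonzero_eq_divide_eq) (algebra+)
  then show ?thesis using that by blast
qed

text \<open>
  If \<open>q\<close> were a multiple of \<open>p\<close>, the two functionals, which agree at \<open>p\<close>, would agree at \<open>q\<close>.
\<close>

lemma plane_basis_functionals: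
  fixes p q w G h :: "real \<times> real"
  assumes "G \<bullet> p = 1" "h \<bullet> p = 1" "G \<bullet> q \<noteq> h \<bullet> q"
  obtains \<mu> \<nu> where "w = \<mu> *\<^sub>R p + \<nu> *\<^sub>R q"
proof (rule plane_basis)
  obtain p1 p2 where p: "p = (p1, p2)" by fastforce
  obtain q1 q2 where q: "q = (q1, q2)" by fastforce
  obtain g1 g2 where g: "G = (g1, g2)" by fastforce
  obtain h1 h2 where h: "h = (h1, h2)" by fastforce
  show "fst p * snd q \<noteq> snd p * fst q"
  proof
    assume "fst p * snd q = snd p * fst q"
    then have D: "p1 * q2 = p2 * q1" using p q by simp
    have e: "g1 * p1 + g2 * p2 = 1" "h1 * p1 + h2 * p2 = 1"
      and ne: "g1 * q1 + g2 * q2 \<noteq> h1 * q1 + h2 * q2" using assms p q g h by auto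
    have "(g1 * q1 + g2 * q2) * 1 = (h1 * q1 + h2 * q2) * 1" using D e by algebra
    with ne show False by simp
  qed
qed (use that in blast)

text \<open>
  The mean of the functionals of the two sides of a v-point exposes the v-point strictly, and the
  two sides cover a neighbourhood of it in the ball.
\<close>

lemma v_point_slice_hull:
  assumes N: "is_norm N" and e: "v_point N e"
  obtains h V \<eta> where "subordinate N h" "h \<bullet> e = 1" "finite V" "V \<subseteq> unit_ball N" "0 < \<eta>"
    "\<And>w. N w \<le> 1 \<Longrightarrow> h \<bullet> w \<le> 1 - \<eta> \<or> w \<in> convex hull V"
proof -
  obtain u v G H where Ne: "N e = 1" and u: "N u = 1" and v: "N v = 1"
    and G: "subordinate N G" "G \<bullet> e = 1" "G \<bullet> u = 1" "G \<bullet> v < 1"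
    and H: "subordinate N H" "H \<bullet> e = 1" "H \<bullet> v = 1" "H \<bullet> u < 1"
    by (rule v_pointE[OF assms])
  define h where "h = (1/2) *\<^sub>R (G + H)"
  have hw: "h \<bullet> w = (G \<bullet> w + H \<bullet> w) / 2" for w by (simp add: h_def inner_add_left)
  have h: "subordinate N h" "h \<bullet> e = 1" "h \<bullet> u < 1" "h \<bullet> v < 1"
  proof -
    have "h \<bullet> w \<le> N w" for w
      using subordinateD[OF G(1), of w] subordinateD[OF H(1), of w] by (simp add: hw)
    then show "subordinate N h" by (simp add: subordinate_def)
  qed (use G H in \<open>simp_all add: hw\<close>)
  define \<eta> where "\<eta> = 1 - max 0 (max (h \<bullet> u) (h \<bullet> v))"
  obtain x y where xy: "v = x *\<^sub>R e + y *\<^sub>R u"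
    using plane_basis_functionals[of G e H u v] G H by auto
  \<comment> \<open>\<open>u\<close> and \<open>v\<close> lie on opposite sides of the line through 0 and \<open>e\<close>.\<close>
  have "y * (1 - H \<bullet> u) < 0"
  proof -
    have "G \<bullet> v = x + y" "H \<bullet> v = x + y * (H \<bullet> u)" using xy G H by (simp_all add: inner_add_right)
    then show ?thesis using G H by (simp add: algebra_simps)
  qed
  then have y: "y < 0" using H by (simp add: mult_less_0_iff)
  have "h \<bullet> w \<le> 1 - \<eta> \<or> w \<in> convex hull {0, e, u, v}" if w: "N w \<le> 1" for w
  proof -
    obtain \<mu> \<nu> where mn: "w = \<mu> *\<^sub>R e + \<nu> *\<^sub>R u"
      using plane_basis_functionals[of G e H u w] G H by auto
    have "w \<in> convex hull {0, e, u} \<or> w \<in> convex hull {0, e, v} \<or> h \<bullet> w \<le> max 0 (max (h \<bullet> u) (h \<bullet> v))"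
    proof (cases "0 \<le> \<nu>")
      case True
      then show ?thesis
        using edge_or_outside_slice[OF N G(1-3) h(1,2) Ne u mn _ w] by auto
    next
      case False
      have uu: "u = (1 / y) *\<^sub>R (v - x *\<^sub>R e)" using xy y by simp
      have "w = (\<mu> - \<nu> * x / y) *\<^sub>R e + (\<nu> / y) *\<^sub>R v"
        by (subst mn, subst uu) (simp add: algebra_simps)
      moreover have "0 \<le> \<nu> / y" using False y by (simp add: divide_nonpos_neg)
      ultimately show ?thesis
        using edge_or_outside_slice[OF N H(1-3) h(1,2) Ne v _ _ w] by fastforce
    qed
    moreover have "convex hull {0, e, u} \<subseteq> convex hull {0, e, u, v}"
      "convex hull {0, e, v} \<subseteq> convex hull {0, e, u, v}" by (intro hull_mono; auto)+
    ultimately show ?thesis by (auto simp: \<eta>_def)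
  qed
  then show ?thesis
    using h Ne u v is_norm_zero[OF N]
    by (intro that[of h "{0, e, u, v}" \<eta>]) (auto simp: \<eta>_def unit_ball_def)
qed

text \<open>
  A supporting line at a v-point contains at most one of the two sides, so the other side leaves it.
\<close>

lemma v_point_edge_leaving:
  assumes N: "is_norm N" and "v_point N p" and h: "subordinate N h" "h \<bullet> p = 1"
  obtains u G where "N u = 1" "subordinate N G" "G \<bullet> p = 1" "G \<bullet> u = 1" "h \<bullet> u < 1"
proof -
  obtain u v where p: "N p = 1" and u: "N u = 1" "N (p + u) = 2" and v: "N v = 1" "N (p + v) = 2"
    and uv: "N (u + v) < 2"
    using assms(2) by (auto simp: v_point_def unit_sphere_def)
  have "h \<bullet> u < 1 \<or> h \<bullet> v < 1"
    using subordinateD[OF h(1), of "u + v"] uv by (simp add: inner_add_right) linarith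
  then show ?thesis
    using common_norming_functional[OF N, of p u] common_norming_functional[OF N, of p v]
      that p u v by (metis one_add_one)
qed

text \<open>
  Between two distinct v-points the functional is forced, and its face is the whole segment.  Beyond
  each end the sphere continues with a side that leaves the face, so the ball is a polygon near it.
\<close>

lemma v_segment_slice_hull:
  assumes N: "is_norm N" and p: "v_point N p" and q: "v_point N q" and "p \<noteq> q"
    and e: "e = (1 - l) *\<^sub>R p + l *\<^sub>R q" "0 < l" "l < 1" "N e = 1"
  obtains h V \<eta> where "subordinate N h" "h \<bullet> e = 1" "finite V" "V \<subseteq> unit_ball N" "0 < \<eta>"
    "\<And>w. N w \<le> 1 \<Longrightarrow> h \<bullet> w \<le> 1 - \<eta> \<or> w \<in> convex hull V"
proof -
  obtain h where h: "subordinate N h" "h \<bullet> e = 1"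
    using norming_functional_exists[OF N, of e] e by metis
  have Np: "N p = 1" and Nq: "N q = 1" using p q by (auto simp: v_point_def unit_sphere_def)
  have le: "h \<bullet> p \<le> 1" "h \<bullet> q \<le> 1" using subordinateD[OF h(1)] Np Nq by metis+
  have conv: "(1 - l) * (1 - h \<bullet> p) + l * (1 - h \<bullet> q) = 0"
    using h(2) e(1) by (simp add: inner_add_right algebra_simps)
  have "(1 - l) * (1 - h \<bullet> p) \<ge> 0" "l * (1 - h \<bullet> q) \<ge> 0" using le e by simp_all
  then have "(1 - l) * (1 - h \<bullet> p) = 0" "l * (1 - h \<bullet> q) = 0" using conv by linarith+
  then have hp: "h \<bullet> p = 1" and hq: "h \<bullet> q = 1" using e by auto
  obtain u G where u: "N u = 1" and G: "subordinate N G" "G \<bullet> p = 1" "G \<bullet> u = 1" and hu: "h \<bullet> u < 1"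
    using v_point_edge_leaving[OF N p h(1) hp] .
  obtain v H where v: "N v = 1" and H: "subordinate N H" "H \<bullet> q = 1" "H \<bullet> v = 1" and hv: "h \<bullet> v < 1"
    using v_point_edge_leaving[OF N q h(1) hq] .
  have basis: "\<exists>x y. w = x *\<^sub>R p + y *\<^sub>R q" for w
  proof -
    have "fst p * snd q \<noteq> snd p * fst q"
    proof
      assume D: "fst p * snd q = snd p * fst q"
      have "fst h * fst p + snd h * snd p = 1" "fst h * fst q + snd h * snd q = 1"
        using hp hq by (simp_all add: inner_prod_def)
      then have "fst p = fst q" "snd p = snd q" using D by algebra+
      then show False using \<open>p \<noteq> q\<close> by (simp add: prod_eq_iff)
    qed
    then show ?thesis using plane_basis by metis
  qed
  have beyond: "w \<in> convex hull {0, p', u'} \<or> h \<bullet> w \<le> max 0 (h \<bullet> u')"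
    if "N p' = 1" "N q' = 1" "h \<bullet> p' = 1" "h \<bullet> q' = 1" "N u' = 1" "subordinate N G'"
      "G' \<bullet> p' = 1" "G' \<bullet> u' = 1" "h \<bullet> u' < 1"
      "u' = x' *\<^sub>R p' + y' *\<^sub>R q'" "w = x *\<^sub>R p' + y *\<^sub>R q'" "y < 0" "N w \<le> 1"
    for p' q' u' w G' x y x' y'
  proof -
    have "y' * (1 - G' \<bullet> q') < 0"
    proof -
      have "G' \<bullet> u' = x' + y' * (G' \<bullet> q')" "h \<bullet> u' = x' + y'"
        unfolding that(10) by (simp_all add: inner_add_right that)
      then show ?thesis using that(8,9) by (simp add: algebra_simps)
    qed
    moreover have "G' \<bullet> q' \<le> 1" using subordinateD[OF that(6), of q'] that by simp
    ultimately have y': "y' < 0" by (auto simp: mult_less_0_iff)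
    then have qq: "q' = (1 / y') *\<^sub>R (u' - x' *\<^sub>R p')" using that(10) by simp
    have "w = (x - y * x' / y') *\<^sub>R p' + (y / y') *\<^sub>R u'"
      by (subst that(11), subst qq) (simp add: algebra_simps)
    moreover have "0 \<le> y / y'" using that(12) y' by (simp add: divide_nonpos_neg)
    ultimately show ?thesis
      using edge_or_outside_slice[OF N that(6-8) h(1) that(3) that(1) that(5) _ _ that(13)] by blast
  qed
  define \<eta> where "\<eta> = 1 - max 0 (max (h \<bullet> u) (h \<bullet> v))"
  let ?V = "{0, p, q, u, v}"
  have "h \<bullet> w \<le> 1 - \<eta> \<or> w \<in> convex hull ?V" if w: "N w \<le> 1" for w
  proof -
    obtain x y where xy: "w = x *\<^sub>R p + y *\<^sub>R q" using basis by blast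
    obtain ux uy where uu: "u = ux *\<^sub>R p + uy *\<^sub>R q" using basis by blast
    obtain vx vy where vv: "v = vx *\<^sub>R p + vy *\<^sub>R q" using basis by blast
    consider "0 \<le> x" "0 \<le> y" | "y < 0" | "x < 0" by linarith
    then show ?thesis
    proof cases
      case 1
      have "x + y \<le> 1"
        using subordinateD[OF h(1), of w] w xy hp hq by (simp add: inner_add_right)
      then have "w \<in> convex hull {0, p, q}"
        using triangle_with_origin xy 1 by blast
      moreover have "convex hull {0, p, q} \<subseteq> convex hull ?V" by (intro hull_mono; auto)
      ultimately show ?thesis by auto
    next
      case 2
      have "convex hull {0, p, u} \<subseteq> convex hull ?V" by (intro hull_mono; auto)
      then show ?thesis
        using beyond[OF Np Nq hp hq u G hu uu xy 2 w] by (auto simp: \<eta>_def)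
    next
      case 3
      have "convex hull {0, q, v} \<subseteq> convex hull ?V" by (intro hull_mono; auto)
      then show ?thesis
        using beyond[OF Nq Np hq hp v H hv _ _ 3 w, of vy vx y] xy vv
        by (auto simp: \<eta>_def add.commute)
    qed
  qed
  then show ?thesis
    using h hu hv Np Nq u v is_norm_zero[OF N]
    by (intro that[of h ?V \<eta>]) (auto simp: \<eta>_def unit_ball_def)
qed


section \<open>Absolute norms\<close>

lemma absolute_norm_abs: "absolute_norm N \<Longrightarrow> N (\<bar>s\<bar>, \<bar>t\<bar>) = N (s, t)"
  unfolding absolute_norm_def by metis

lemma absolute_norm_reflect: "absolute_norm N \<Longrightarrow> N (- s, t) = N (s, t)"
  unfolding absolute_norm_def by (metis abs_minus_cancel)

lemma absolute_norm_swap: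
  assumes "absolute_norm N"
  shows "absolute_norm (\<lambda>(s, t). N (t, s))"
proof -
  have N: "is_norm N" using assms by (simp add: absolute_norm_def)
  have "is_norm (\<lambda>(s, t). N (t, s))"
    unfolding is_norm_def
  proof (intro conjI allI; clarsimp)
    show "0 \<le> N (t, s)" for s t by (rule is_norm_nonneg[OF N])
    show "N (t, s) = 0 \<longleftrightarrow> (s, t) = 0" for s t
      using N unfolding is_norm_def by (auto simp: zero_prod_def)
    show "N (c * t, c * s) = \<bar>c\<bar> * N (t, s)" for c s t
      using is_norm_scaleR[OF N, of c "(t, s)"] by simp
    show "N (t + t', s + s') \<le> N (t, s) + N (t', s')" for s t s' t'
      using is_norm_triangle[OF N, of "(t, s)" "(t', s')"] by simp
  qed
  then show ?thesis using absolute_norm_abs[OF assms] by (simp add: absolute_norm_def)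
qed

text \<open>
  \<open>(s, t)\<close> is a convex combination of \<open>(s', t)\<close> and its mirror image \<open>(- s', t)\<close>.
\<close>

lemma absolute_norm_mono_fst:
  assumes N: "absolute_norm N" and "\<bar>s\<bar> \<le> \<bar>s'\<bar>"
  shows "N (s, t) \<le> N (s', t)"
proof (cases "s' = 0")
  case False
  have "is_norm N" using N by (simp add: absolute_norm_def)
  define l where "l = (1 + \<bar>s\<bar> / \<bar>s'\<bar>) / 2"
  have l: "0 \<le> l" "l \<le> 1" using assms False by (simp_all add: l_def field_simps)
  have "(\<bar>s\<bar>, t) = l *\<^sub>R (\<bar>s'\<bar>, t) + (1 - l) *\<^sub>R (- \<bar>s'\<bar>, t)"
    using False by (simp add: l_def field_simps)
  then have "N (\<bar>s\<bar>, t) \<le> l * N (\<bar>s'\<bar>, t) + (1 - l) * N (- \<bar>s'\<bar>, t)"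
    using is_norm_triangle[OF \<open>is_norm N\<close>, of "l *\<^sub>R (\<bar>s'\<bar>, t)" "(1 - l) *\<^sub>R (- \<bar>s'\<bar>, t)"] l
    by (simp only: is_norm_scaleR[OF \<open>is_norm N\<close>]; simp)
  also have "\<dots> = N (\<bar>s'\<bar>, t)" by (simp add: absolute_norm_reflect[OF N] algebra_simps)
  finally show ?thesis using absolute_norm_abs[OF N] by (metis abs_idempotent)
qed (use assms in simp)

lemma absolute_norm_mono:
  assumes N: "absolute_norm N" and "\<bar>s\<bar> \<le> \<bar>s'\<bar>" "\<bar>t\<bar> \<le> \<bar>t'\<bar>"
  shows "N (s, t) \<le> N (s', t')"
  using absolute_norm_mono_fst[OF N assms(2), of t]
    absolute_norm_mono_fst[OF absolute_norm_swap[OF N] assms(3), of s'] by simp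

lemma absolute_normalized_bounds:
  assumes N: "absolute_norm N" and "normalized_norm N"
  shows "\<bar>s\<bar> \<le> N (s, t)" "\<bar>t\<bar> \<le> N (s, t)" and "N (s, 0) = \<bar>s\<bar>" "N (0, t) = \<bar>t\<bar>"
proof -
  have n: "is_norm N" "N (1, 0) = 1" "N (0, 1) = 1"
    using assms by (simp_all add: normalized_norm_def)
  show 1: "N (s, 0) = \<bar>s\<bar>" and 2: "N (0, t) = \<bar>t\<bar>"
    using is_norm_scaleR[OF n(1), of s "(1, 0)"] is_norm_scaleR[OF n(1), of t "(0, 1)"] n by simp_all
  show "\<bar>s\<bar> \<le> N (s, t)" "\<bar>t\<bar> \<le> N (s, t)"
    using absolute_norm_mono[OF N, of s s 0 t] absolute_norm_mono[OF N, of 0 s t t] 1 2 by simp_all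
qed

lemma subordinate_reflect:
  assumes N: "absolute_norm N" and "subordinate N (m, n)"
  shows "subordinate N (- m, n)"
  unfolding subordinate_def
proof clarify
  fix s t show "(- m, n) \<bullet> (s, t) \<le> N (s, t)"
    using subordinateD[OF assms(2), of "(- s, t)"] by (simp add: absolute_norm_reflect[OF N])
qed

lemma subordinate_abs:
  assumes N: "absolute_norm N" and "subordinate N (m, n)"
  shows "subordinate N (\<bar>m\<bar>, \<bar>n\<bar>)"
  unfolding subordinate_def
proof clarify
  fix s t
  have "(m, n) \<bullet> (sgn m * \<bar>s\<bar>, sgn n * \<bar>t\<bar>) \<le> N (sgn m * \<bar>s\<bar>, sgn n * \<bar>t\<bar>)"
    by (rule subordinateD[OF assms(2)])
  also have "\<dots> \<le> N (s, t)"
    by (rule absolute_norm_mono[OF N]) (auto simp: sgn_if)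
  also have "(m, n) \<bullet> (sgn m * \<bar>s\<bar>, sgn n * \<bar>t\<bar>) = \<bar>m\<bar> * \<bar>s\<bar> + \<bar>n\<bar> * \<bar>t\<bar>"
    by (auto simp: sgn_if)
  finally have "\<bar>m\<bar> * \<bar>s\<bar> + \<bar>n\<bar> * \<bar>t\<bar> \<le> N (s, t)" .
  moreover have "\<bar>m\<bar> * s \<le> \<bar>m\<bar> * \<bar>s\<bar>" "\<bar>n\<bar> * t \<le> \<bar>n\<bar> * \<bar>t\<bar>" by (auto intro: mult_left_mono)
  ultimately show "(\<bar>m\<bar>, \<bar>n\<bar>) \<bullet> (s, t) \<le> N (s, t)" by simp
qed

lemma inner_le_convex_hull_generator:
  fixes V :: "'e::real_inner set"
  assumes "w \<in> convex hull V"
  shows "\<exists>v\<in>V. G \<bullet> w \<le> G \<bullet> v"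
proof (rule ccontr)
  assume "\<not> ?thesis"
  then have "V \<subseteq> {v. G \<bullet> v < G \<bullet> w}" by force
  then have "convex hull V \<subseteq> {v. G \<bullet> v < G \<bullet> w}"
    by (rule hull_minimal) (rule convex_halfspace_lt)
  then show False using assms by auto
qed

text \<open>
  The polygon near the v-points, made positive: replacing \<open>h\<close> and the vertices by their absolute values
  loses nothing, because \<open>N\<close> is absolute and only functionals \<open>(m, n)\<close> with nonnegative coordinates are
  tested.
\<close>

lemma positive_slice_from_v_points:
  assumes N: "absolute_norm N" and ab: "0 \<le> a" "0 \<le> b" "N (a, b) = 1"
    and p: "v_point N p" and q: "v_point N q" and seg: "(a, b) \<in> closed_segment p q"
  obtains c d V \<eta> where "0 \<le> c" "0 \<le> d" "subordinate N (c, d)" "c * a + d * b = 1"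
    "finite V" "\<And>s t. (s, t) \<in> V \<Longrightarrow> 0 \<le> s \<and> 0 \<le> t \<and> N (s, t) \<le> 1" "0 < \<eta>"
    "\<And>w m n. N w \<le> 1 \<Longrightarrow> 0 \<le> m \<Longrightarrow> 0 \<le> n \<Longrightarrow>
      (c, d) \<bullet> w \<le> 1 - \<eta> \<or> (\<exists>v\<in>V. (m, n) \<bullet> w \<le> (m, n) \<bullet> v)"
proof -
  have n: "is_norm N" using N by (simp add: absolute_norm_def)
  obtain h V \<eta> where h: "subordinate N h" "h \<bullet> (a, b) = 1" and V: "finite V" "V \<subseteq> unit_ball N"
    and \<eta>: "0 < \<eta>" and hull: "\<And>w. N w \<le> 1 \<Longrightarrow> h \<bullet> w \<le> 1 - \<eta> \<or> w \<in> convex hull V"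
  proof (cases "v_point N (a, b)")
    case True
    then show ?thesis using v_point_slice_hull[OF n True] that by blast
  next
    case False
    obtain l where l: "0 \<le> l" "l \<le> 1" "(a, b) = (1 - l) *\<^sub>R p + l *\<^sub>R q"
      using seg by (auto simp: in_segment)
    have "p \<noteq> q" using False p seg by auto
    have "l \<noteq> 0" "l \<noteq> 1" using False p q l by auto
    then have "0 < l" "l < 1" using l by auto
    then show ?thesis
      by (rule v_segment_slice_hull[OF n p q \<open>p \<noteq> q\<close> l(3) _ _ ab(3)]) (rule that)
  qed
  obtain c d where cd: "h = (c, d)" by fastforce
  define V' where "V' = (\<lambda>(s, t). (\<bar>s\<bar>, \<bar>t\<bar>)) ` V"
  have sub: "subordinate N (\<bar>c\<bar>, \<bar>d\<bar>)" using subordinate_abs[OF N] h cd by blast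
  show ?thesis
  proof (rule that[of "\<bar>c\<bar>" "\<bar>d\<bar>" V' \<eta>])
    show "0 \<le> \<bar>c\<bar>" "0 \<le> \<bar>d\<bar>" "finite V'" "0 < \<eta>" using V \<eta> by (auto simp: V'_def)
    show "subordinate N (\<bar>c\<bar>, \<bar>d\<bar>)" by (rule sub)
    have "c * a \<le> \<bar>c\<bar> * a" "d * b \<le> \<bar>d\<bar> * b" using ab by (simp_all add: mult_right_mono)
    then show "\<bar>c\<bar> * a + \<bar>d\<bar> * b = 1"
      using subordinateD[OF sub, of "(a, b)"] h(2) ab cd by simp
    show "0 \<le> s \<and> 0 \<le> t \<and> N (s, t) \<le> 1" if "(s, t) \<in> V'" for s t
      using that V by (auto simp: V'_def unit_ball_def absolute_norm_abs[OF N])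
    fix w and m n :: real assume w: "N w \<le> 1" and mn: "0 \<le> m" "0 \<le> n"
    obtain s t where st: "w = (s, t)" by fastforce
    \<comment> \<open>Undo the change of signs of \<open>h\<close> at the point \<open>w\<close>.\<close>
    define \<epsilon> \<delta> :: real where "\<epsilon> = (if c < 0 then -1 else 1)" and "\<delta> = (if d < 0 then -1 else 1)"
    have sgns: "\<epsilon> * \<epsilon> = 1" "\<delta> * \<delta> = 1" "\<bar>c\<bar> = c * \<epsilon>" "\<bar>d\<bar> = d * \<delta>" "\<bar>\<epsilon>\<bar> = 1" "\<bar>\<delta>\<bar> = 1"
      by (auto simp: \<epsilon>_def \<delta>_def)
    have "N (\<epsilon> * s, \<delta> * t) \<le> 1"
      using absolute_norm_mono[OF N, of "\<epsilon> * s" s "\<delta> * t" t] sgns w st by (simp add: abs_mult)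
    from hull[OF this] show "(\<bar>c\<bar>, \<bar>d\<bar>) \<bullet> w \<le> 1 - \<eta> \<or> (\<exists>v\<in>V'. (m, n) \<bullet> w \<le> (m, n) \<bullet> v)"
    proof
      assume "h \<bullet> (\<epsilon> * s, \<delta> * t) \<le> 1 - \<eta>"
      then show ?thesis by (simp add: cd st sgns mult.assoc)
    next
      assume "(\<epsilon> * s, \<delta> * t) \<in> convex hull V"
      then obtain v where v: "v \<in> V" "(m * \<epsilon>, n * \<delta>) \<bullet> (\<epsilon> * s, \<delta> * t) \<le> (m * \<epsilon>, n * \<delta>) \<bullet> v"
        using inner_le_convex_hull_generator by blast
      have "(m * \<epsilon>, n * \<delta>) \<bullet> (\<epsilon> * s, \<delta> * t) = m * (\<epsilon> * \<epsilon>) * s + n * (\<delta> * \<delta>) * t"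
        by (simp add: algebra_simps)
      also have "\<dots> = (m, n) \<bullet> w" by (simp add: sgns st)
      finally have 1: "(m, n) \<bullet> w \<le> (m * \<epsilon>, n * \<delta>) \<bullet> v" using v by simp
      have "m * (\<epsilon> * fst v) \<le> m * \<bar>fst v\<bar>" "n * (\<delta> * snd v) \<le> n * \<bar>snd v\<bar>"
        by (rule mult_left_mono; use mn in \<open>auto simp: \<epsilon>_def \<delta>_def\<close>)+
      then have "(m * \<epsilon>, n * \<delta>) \<bullet> v \<le> (m, n) \<bullet> (\<bar>fst v\<bar>, \<bar>snd v\<bar>)"
        by (simp add: inner_prod_def mult.assoc)
      moreover have "(\<bar>fst v\<bar>, \<bar>snd v\<bar>) \<in> V'"
        unfolding V'_def using v(1) by (rule rev_image_eqI) (simp add: case_prod_beta)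
      ultimately show ?thesis using 1 by (meson order_trans)
    qed
  qed
qed

section \<open>Flat edges next to a face\<close>

text \<open>
  The points \<open>q + s \<tau>\<close> run along the line \<open>h = 1\<close>, so their radial projections run along the sphere,
  with \<open>q\<close> at \<open>s = 0\<close>.  The conclusion says that the sphere continues with a segment beyond \<open>q\<close>.  If
  it does not, then some \<open>0 < s < s0\<close> has the property that no segment of the sphere joins the
  direction of \<open>q + s \<tau>\<close> to that of \<open>q + s0 \<tau>\<close>, nor to \<open>q\<close>.  A face through that direction is thus
  trapped strictly between them.  A segment from one of its points to a point \<open>q - t \<tau>\<close> of the
  sphere passes \<open>q\<close>, which is a contradiction.
\<close>

lemma edge_beyond_face:
  fixes q \<tau> :: "'e::euclidean_space"
  assumes N: "is_norm N" and h: "h \<bullet> q = 1" "h \<bullet> \<tau> = 0" and Nq: "N q = 1"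
    and basis: "\<And>w. \<exists>x y. w = x *\<^sub>R q + y *\<^sub>R \<tau>" and s0: "0 < s0"
    and far: "\<And>G. subordinate N G \<Longrightarrow> exposed_face N G \<noteq> {} \<Longrightarrow>
      exposed_face N G \<subseteq> {l *\<^sub>R (q + s *\<^sub>R \<tau>) | l s. 0 < l \<and> 0 < s \<and> s < s0} \<Longrightarrow>
      \<exists>w\<in>exposed_face N G. \<exists>t\<ge>0. N (q - t *\<^sub>R \<tau>) = 1 \<and> N (q - t *\<^sub>R \<tau> + w) = 2"
  shows "\<exists>s>0. \<exists>G. subordinate N G \<and> G \<bullet> q = 1 \<and> G \<bullet> (q + s *\<^sub>R \<tau>) = N (q + s *\<^sub>R \<tau>)"
proof (rule ccontr)
  assume no: "\<not> ?thesis"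
  let ?u = "\<lambda>s. q + s *\<^sub>R \<tau>"
  have pos: "0 < N (?u s)" for s
  proof (rule is_norm_pos[OF N])
    have "h \<bullet> ?u s = 1" using h by (simp add: inner_add_right)
    then show "?u s \<noteq> 0" by force
  qed
  \<comment> \<open>By continuity, segments from \<open>?u s\<close> to \<open>?u s0\<close> for all small \<open>s\<close> would give one from \<open>q\<close>.\<close>
  have "\<exists>s. 0 < s \<and> s < s0 \<and> N (?u s + ?u s0) \<noteq> N (?u s) + N (?u s0)"
  proof (rule ccontr)
    assume "\<not> ?thesis"
    then have eq: "N (?u s + ?u s0) = N (?u s) + N (?u s0)" if "0 < s" "s < s0" for s
      using that by blast
    let ?f = "\<lambda>s. N (?u s + ?u s0) - (N (?u s) + N (?u s0))"
    have "continuous_on UNIV ?f"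
      by (intro continuous_intros continuous_on_compose2[OF is_norm_continuous_on[OF N, of UNIV]]) auto
    then have "isCont ?f 0" by (simp only: continuous_on_eq_continuous_at[OF open_UNIV] UNIV_I)
    then have "(?f \<longlongrightarrow> ?f 0) (at_right 0)"
      unfolding isCont_def by (rule filterlim_mono) (auto intro: at_le)
    moreover have "(?f \<longlongrightarrow> 0) (at_right 0)"
    proof (rule tendsto_eventually)
      show "\<forall>\<^sub>F s in at_right 0. ?f s = 0"
        unfolding eventually_at_right_field using s0 eq by auto
    qed
    ultimately have "?f 0 = 0" using tendsto_unique[OF trivial_limit_at_right_real] by blast
    then obtain G where "subordinate N G" "G \<bullet> q = 1" "G \<bullet> ?u s0 = N (?u s0)"
      using common_norming_functional[OF N, of q "?u s0"] Nq by auto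
    then show False using no s0 by blast
  qed
  then obtain s where s: "0 < s" "s < s0" and kink: "N (?u s + ?u s0) \<noteq> N (?u s) + N (?u s0)" by blast
  obtain G where G: "subordinate N G" "G \<bullet> ?u s = N (?u s)"
    using norming_functional_exists[OF N] by blast
  have Gq: "G \<bullet> q \<noteq> 1" using no G s by blast
  have Gs0: "G \<bullet> ?u s0 \<noteq> N (?u s0)"
    using norm_add_eq_if_common_functional[OF N G(1,2)] kink by blast
  note cone = norming_functional_cone[OF N G]
  have lin: "\<mu> *\<^sub>R ?u s + \<nu> *\<^sub>R (x *\<^sub>R q + y *\<^sub>R \<tau>) = (\<mu> + \<nu> * x) *\<^sub>R q + (\<mu> * s + \<nu> * y) *\<^sub>R \<tau>"
    for \<mu> \<nu> x y by (simp add: algebra_simps)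
  have arc: "\<exists>l r. w = l *\<^sub>R ?u r \<and> 0 < l \<and> 0 < r \<and> r < s0" if w: "w \<in> exposed_face N G" for w
  proof -
    obtain x y where xy: "w = x *\<^sub>R q + y *\<^sub>R \<tau>" using basis by blast
    have Gw: "G \<bullet> w = N w" "G \<bullet> w = 1"
      using w exposed_face_norm[OF G(1) w] by (auto simp: exposed_face_def)
    \<comment> \<open>The coefficients express \<open>?u s0\<close>, and \<open>q\<close> in the next step, in the cone of \<open>?u s\<close>
      and \<open>w\<close>, where \<open>G\<close> norms.\<close>
    have before_s0: "y < x * s0" if "y > x * s"
    proof (rule ccontr)
      assume c: "\<not> ?thesis"
      define \<nu> \<mu> where "\<nu> = (s0 - s) / (y - x * s)" and "\<mu> = (y - x * s0) / (y - x * s)"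
      have "0 \<le> \<nu>" "0 \<le> \<mu>" using that s c by (simp_all add: \<nu>_def \<mu>_def divide_nonpos_pos)
      moreover have "\<mu> + \<nu> * x = 1" "\<mu> * s + \<nu> * y = s0"
        using that by (simp_all add: \<nu>_def \<mu>_def add_divide_distrib[symmetric] divide_eq_eq algebra_simps)
      then have "?u s0 = \<mu> *\<^sub>R ?u s + \<nu> *\<^sub>R w"
        unfolding xy lin by simp
      ultimately show False using cone[of w \<mu> \<nu>] Gw Gs0 by simp
    qed
    have after_0: "0 < y" if "y < x * s"
    proof (rule ccontr)
      assume c: "\<not> ?thesis"
      define \<nu> \<mu> where "\<nu> = s / (x * s - y)" and "\<mu> = (- y) / (x * s - y)"
      have "0 \<le> \<nu>" "0 \<le> \<mu>" using that s c by (simp_all add: \<nu>_def \<mu>_def divide_nonpos_pos)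
      moreover have "\<mu> + \<nu> * x = 1" "\<mu> * s + \<nu> * y = 0"
        using that by (simp_all add: \<nu>_def \<mu>_def diff_divide_distrib[symmetric] divide_eq_eq mult.commute)
      then have "q = \<mu> *\<^sub>R ?u s + \<nu> *\<^sub>R w"
        unfolding xy lin by simp
      ultimately show False using cone[of w \<mu> \<nu>] Gw Gq Nq by simp
    qed
    have x: "0 < x"
    proof -
      consider "y > x * s" | "y < x * s" | "y = x * s" by linarith
      then show ?thesis
      proof cases
        case 1
        then have "0 < x * (s0 - s)" using before_s0 by (simp add: algebra_simps)
        then show ?thesis using s by (simp add: zero_less_mult_iff)
      next
        case 2
        then have "0 < x * s" using after_0 by linarith
        then show ?thesis using s by (simp add: zero_less_mult_iff)
      next
        case 3
        then have "w = x *\<^sub>R ?u s" using xy by (simp add: algebra_simps)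
        then have "x * N (?u s) = 1" using Gw G by simp
        then show ?thesis using pos[of s] by (metis zero_less_mult_iff zero_less_one less_asym)
      qed
    qed
    have "0 < y \<and> y < x * s0"
    proof -
      have "0 < x * s" "x * s < x * s0" using x s by simp_all
      then show ?thesis using before_s0 after_0 by linarith
    qed
    then have "w = x *\<^sub>R ?u (y / x)" "0 < y / x" "y / x < s0"
      using x xy by (simp_all add: algebra_simps divide_simps mult.commute)
    then show ?thesis using x by blast
  qed
  have "(1 / N (?u s)) *\<^sub>R ?u s \<in> exposed_face N G"
    using pos[of s] G(2) unfolding exposed_face_def unit_ball_def
    by (simp only: is_norm_scaleR[OF N] inner_scaleR_right mem_Collect_eq; simp)
  then have "exposed_face N G \<noteq> {}" by blast
  then obtain w t where w: "w \<in> exposed_face N G" and t: "0 \<le> t" "N (q - t *\<^sub>R \<tau>) = 1" "N (q - t *\<^sub>R \<tau> + w) = 2"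
    using far[OF G(1)] arc by blast
  obtain l r where lr: "w = l *\<^sub>R ?u r" "0 < l" "0 < r" using arc[OF w] by blast
  have "N w = 1" using exposed_face_norm[OF G(1) w] .
  then obtain L where L: "subordinate N L" "L \<bullet> (q - t *\<^sub>R \<tau>) = 1" "L \<bullet> w = 1"
    using common_norming_functional[OF N, of "q - t *\<^sub>R \<tau>" w] t by auto
  have Lr: "L \<bullet> ?u r = N (?u r)"
  proof -
    have "l * (L \<bullet> ?u r) = l * N (?u r)"
      using L(3) \<open>N w = 1\<close> lr is_norm_scaleR[OF N, of l "?u r"] by simp
    then show ?thesis using lr by simp
  qed
  have "L \<bullet> q = 1"
  proof -
    have "(r + t) *\<^sub>R q = r *\<^sub>R (q - t *\<^sub>R \<tau>) + t *\<^sub>R ?u r" by (simp add: algebra_simps)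
    then have "L \<bullet> ((r + t) *\<^sub>R q) = N ((r + t) *\<^sub>R q)"
      using norming_functional_cone[OF N L(1), of "q - t *\<^sub>R \<tau>" "?u r" r t] L t Lr lr by simp
    then have "(r + t) * (L \<bullet> q) = (r + t) * 1" using lr t Nq by (simp add: is_norm_scaleR[OF N])
    then show ?thesis using lr t by simp
  qed
  then show False using no L(1) Lr lr by blast
qed

text \<open>
  What the relative Daugavet property of \<open>(ax, by)\<close> leaves in the plane.  Only functionals with
  nonnegative coordinates are tested, since \<open>(m, n)\<close> stands for the norms of a pair of functionals.
\<close>

definition positively_Daugavet :: "(real \<times> real \<Rightarrow> real) \<Rightarrow> real \<times> real \<Rightarrow> real \<times> real \<Rightarrow> real \<Rightarrow> bool" where
  "positively_Daugavet N e h \<alpha> \<longleftrightarrow>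
     (\<forall>m n. 0 \<le> m \<longrightarrow> 0 \<le> n \<longrightarrow> subordinate N (m, n) \<longrightarrow> exposed_face N (m, n) \<noteq> {} \<longrightarrow>
       (\<forall>w\<in>exposed_face N (m, n). h \<bullet> w > 1 - \<alpha>) \<longrightarrow>
       (\<exists>w\<in>exposed_face N (m, n). N (e + w) = 2))"

text \<open>Otherwise \<open>(m, n)\<close> would be larger at the mirror image \<open>(- s, t)\<close>.\<close>

lemma subordinate_sign_fst:
  assumes "absolute_norm N" "subordinate N (m, n)" "(s, t) \<in> exposed_face N (m, n)"
  shows "0 \<le> m * s"
proof -
  have "m * (- s) + n * t \<le> N (s, t)"
    using subordinateD[OF assms(2), of "(- s, t)"] absolute_norm_reflect[OF assms(1)] by simp
  then show ?thesis using assms(3) exposed_face_norm[OF assms(2,3)] by (simp add: exposed_face_def)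
qed

lemma subordinate_swap: "subordinate N (m, n) \<Longrightarrow> subordinate (\<lambda>(s, t). N (t, s)) (n, m)"
  unfolding subordinate_def by (auto simp: algebra_simps)

lemma subordinate_sign_snd:
  assumes "absolute_norm N" "subordinate N (m, n)" "(s, t) \<in> exposed_face N (m, n)"
  shows "0 \<le> n * t"
  by (rule subordinate_sign_fst[OF absolute_norm_swap[OF assms(1)] subordinate_swap[OF assms(2)], of t s])
    (use assms(3) in \<open>auto simp: exposed_face_def unit_ball_def\<close>)

lemma face_endpoint:
  fixes e :: "'e::euclidean_space"
  assumes N: "is_norm N" and h: "subordinate N h" "h \<bullet> e = 1" "h \<bullet> \<tau> = 0" and e: "N e = 1" and "\<tau> \<noteq> 0"
  obtains r where "0 \<le> r" "N (e + r *\<^sub>R \<tau>) = 1" "\<And>s. r < s \<Longrightarrow> 1 < N (e + s *\<^sub>R \<tau>)"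
    "\<And>s. 0 \<le> s \<Longrightarrow> s \<le> r \<Longrightarrow> N (e + s *\<^sub>R \<tau>) = 1"
proof -
  have N\<tau>: "0 < N \<tau>" by (rule is_norm_pos[OF N \<open>\<tau> \<noteq> 0\<close>])
  have ge: "1 \<le> N (e + s *\<^sub>R \<tau>)" for s
    using subordinateD[OF h(1), of "e + s *\<^sub>R \<tau>"] h by (simp add: inner_add_right)
  let ?S = "{s. N (e + s *\<^sub>R \<tau>) = 1}"
  have "continuous_on UNIV (\<lambda>s. N (e + s *\<^sub>R \<tau>))"
    by (intro continuous_on_compose2[OF is_norm_continuous_on[OF N, of UNIV]] continuous_intros) auto
  then have closed: "closed ?S" by (intro closed_Collect_eq continuous_on_const)
  have bdd: "bdd_above ?S"
  proof
    fix s assume "s \<in> ?S"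
    then have "N (s *\<^sub>R \<tau>) \<le> 2"
      using is_norm_triangle[OF N, of "e + s *\<^sub>R \<tau>" "- e"] e by (simp add: is_norm_minus[OF N])
    then have "\<bar>s\<bar> * N \<tau> \<le> 2" by (simp add: is_norm_scaleR[OF N])
    then show "s \<le> 2 / N \<tau>" using N\<tau> by (simp add: field_simps) (smt (verit) mult_right_mono)
  qed
  have 0: "0 \<in> ?S" using e by simp
  then have "?S \<noteq> {}" by blast
  then have S: "Sup ?S \<in> ?S" using bdd closed by (rule closed_contains_Sup)
  show ?thesis
  proof
    show "0 \<le> Sup ?S" using bdd 0 by (rule cSup_upper[rotated])
    show "N (e + Sup ?S *\<^sub>R \<tau>) = 1" using S by simp
    show "1 < N (e + s *\<^sub>R \<tau>)" if "Sup ?S < s" for s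
    proof -
      have "s \<notin> ?S" using that cSup_upper[OF _ bdd, of s] by auto
      then show ?thesis using ge[of s] by simp
    qed
    show "N (e + s *\<^sub>R \<tau>) = 1" if "0 \<le> s" "s \<le> Sup ?S" for s
    proof (cases "Sup ?S = 0")
      case False
      define l where "l = s / Sup ?S"
      have l: "0 \<le> l" "l \<le> 1" "l * Sup ?S = s" using that False by (simp_all add: l_def)
      have "e + s *\<^sub>R \<tau> = (1 - l) *\<^sub>R e + l *\<^sub>R (e + Sup ?S *\<^sub>R \<tau>)"
        using l(3) by (simp add: algebra_simps)
      then have "N (e + s *\<^sub>R \<tau>) \<le> (1 - l) * N e + l * N (e + Sup ?S *\<^sub>R \<tau>)"
        using is_norm_triangle[OF N, of "(1 - l) *\<^sub>R e" "l *\<^sub>R (e + Sup ?S *\<^sub>R \<tau>)"] l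
        by (simp only: is_norm_scaleR[OF N]; simp)
      then show ?thesis using ge[of s] e S by simp
    qed (use that e in simp)
  qed
qed

text \<open>
  The face of \<open>h = (c, d)\<close> is followed from \<open>e = (a, b)\<close> in the direction \<open>\<tau> = (- d, c)\<close> to its end
  \<open>q = (q1, q2)\<close>, and \<open>edge_beyond_face\<close> is applied there.  The faces that occur in it are tested by
  functionals \<open>(m, n)\<close> with \<open>n \<ge> 0\<close>.  If \<open>q1 > 0\<close>, then close to \<open>q\<close> also \<open>m \<ge> 0\<close>, and the
  hypothesis applies.  Otherwise the arc beyond \<open>q\<close> is in the second quadrant and \<open>m \<le> 0\<close>.  Then
  the hypothesis is applied to \<open>(- m, n)\<close>, and reflecting back replaces \<open>e\<close> by \<open>(- a, b)\<close>.  This point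
  still belongs to the face of \<open>h\<close>, except when \<open>c a > 0\<close>.  In that case \<open>q = (0, 1)\<close>, and the mirror
  image of the face of \<open>h\<close> provides the segment.
\<close>

lemma flat_edge_after_face:
  assumes N: "absolute_norm N" and nN: "normalized_norm N"
    and ab: "0 \<le> a" "0 \<le> b" "N (a, b) = 1" and cd: "0 \<le> c" "0 \<le> d"
    and h: "subordinate N (c, d)" "c * a + d * b = 1" and \<alpha>: "0 < \<alpha>"
    and D: "positively_Daugavet N (a, b) (c, d) \<alpha>"
  obtains r s G where "0 \<le> r" "N (a - r * d, b + r * c) = 1"
    "\<And>s. r < s \<Longrightarrow> 1 < N (a - s * d, b + s * c)"
    "0 < s" "subordinate N G" "G \<bullet> (a - r * d, b + r * c) = 1"
    "G \<bullet> (a - (r + s) * d, b + (r + s) * c) = N (a - (r + s) * d, b + (r + s) * c)"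
proof -
  have n: "is_norm N" using N by (simp add: absolute_norm_def)
  define \<tau> where "\<tau> = (- d, c)"
  have h\<tau>: "(c, d) \<bullet> \<tau> = 0" by (simp add: \<tau>_def)
  have "\<tau> \<noteq> 0" using h(2) by (auto simp: \<tau>_def zero_prod_def)
  then have N\<tau>: "0 < N \<tau>" by (rule is_norm_pos[OF n])
  have he: "(c, d) \<bullet> (a, b) = 1" using h(2) by simp
  obtain r where r: "0 \<le> r" "N ((a, b) + r *\<^sub>R \<tau>) = 1" "\<And>s. r < s \<Longrightarrow> 1 < N ((a, b) + s *\<^sub>R \<tau>)"
    and face: "\<And>s. 0 \<le> s \<Longrightarrow> s \<le> r \<Longrightarrow> N ((a, b) + s *\<^sub>R \<tau>) = 1"
    using face_endpoint[OF n h(1) he h\<tau> ab(3) \<open>\<tau> \<noteq> 0\<close>] by blast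
  define q1 q2 where "q1 = a - r * d" and "q2 = b + r * c"
  define q where "q = (q1, q2)"
  have q: "q = (a, b) + r *\<^sub>R \<tau>" by (simp add: q_def q1_def q2_def \<tau>_def)
  have Nq: "N q = 1" using r q by simp
  have hq: "(c, d) \<bullet> q = 1" using he h\<tau> by (simp add: q inner_add_right)
  have hq': "c * q1 + d * q2 = 1" using hq by (simp add: q_def)
  have q2: "0 \<le> q2" using ab cd r by (simp add: q2_def)
  have qs: "q + s *\<^sub>R \<tau> = (q1 - s * d, q2 + s * c)" for s by (simp add: q_def \<tau>_def)
  have q1: "0 \<le> q1" if "0 < c"
  proof (rule ccontr)
    assume neg: "\<not> ?thesis"
    have "(c, d) \<bullet> (- q1, q2) \<le> 1"
      using subordinateD[OF h(1), of "(- q1, q2)"] Nq absolute_norm_reflect[OF N] by (simp add: q_def)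
    then have "c * (2 * q1) \<ge> 0" using hq' by simp
    then show False using that neg by (simp add: zero_le_mult_iff)
  qed
  have "\<exists>s>0. \<exists>G. subordinate N G \<and> G \<bullet> q = 1 \<and> G \<bullet> (q + s *\<^sub>R \<tau>) = N (q + s *\<^sub>R \<tau>)"
  proof (cases "q1 \<le> 0 \<and> 0 < c * a")
    case True
    then have "0 < c" "0 < a" using cd ab by (auto simp: zero_less_mult_iff)
    then have "q1 = 0" using q1 True by simp
    then have "q2 = 1" using Nq q2 absolute_normalized_bounds(4)[OF N nN, of q2] by (simp add: q_def)
    then have "d = 1" using hq' \<open>q1 = 0\<close> by simp
    then have "r = a" using \<open>q1 = 0\<close> by (simp add: q1_def)
    \<comment> \<open>\<open>k\<close> is the value of the reflected functional \<open>(- c, d)\<close> at \<open>q + r \<tau>\<close>.\<close>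
    define k where "k = 1 + 2 * r * c"
    have k: "1 \<le> k" "0 < r" using r \<open>0 < a\<close> \<open>r = a\<close> cd by (simp_all add: k_def)
    have "N (q + r *\<^sub>R \<tau>) = N (r, 1 + r * c)"
      using \<open>q1 = 0\<close> \<open>q2 = 1\<close> \<open>d = 1\<close> absolute_norm_reflect[OF N] by (simp add: qs)
    also have "(r, 1 + r * c) = k *\<^sub>R ((a, b) + (r - r / k) *\<^sub>R \<tau>)"
    proof -
      have "b = 1 - r * c" using \<open>q2 = 1\<close> by (simp add: q2_def)
      moreover have "k * (r - r / k) = k * r - r" using k by (simp add: field_simps)
      then have "k * (b + (r - r / k) * c) = k * b + (k * r - r) * c"
        by (simp only: distrib_left mult.assoc[symmetric])
      moreover have "k * b + (k * r - r) * c = k * (b + r * c) - r * c" by (simp add: algebra_simps)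
      ultimately have "k * (b + (r - r / k) * c) = 1 + r * c" by (simp add: k_def)
      moreover have "k * (a - (r - r / k)) = r" using k \<open>r = a\<close> by simp
      moreover have "(a, b) + (r - r / k) *\<^sub>R \<tau> = (a - (r - r / k), b + (r - r / k) * c)"
        by (simp add: \<tau>_def \<open>d = 1\<close>)
      ultimately show ?thesis by (simp only: scaleR_Pair real_scaleR_def)
    qed
    also have "N \<dots> = k"
    proof -
      have "r / k \<le> r" using k by (simp add: field_simps)
      moreover have "0 \<le> r / k" using k by simp
      ultimately show ?thesis using face[of "r - r / k"] k by (simp only: is_norm_scaleR[OF n]; simp)
    qed
    finally have "N (q + r *\<^sub>R \<tau>) = k" .
    moreover have "(- c, d) \<bullet> (q + r *\<^sub>R \<tau>) = k" "(- c, d) \<bullet> q = 1"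
      using \<open>q1 = 0\<close> \<open>q2 = 1\<close> \<open>d = 1\<close>
      unfolding qs unfolding q_def by (simp_all add: k_def)
    ultimately show ?thesis using subordinate_reflect[OF N h(1)] k by metis
  next
    case False
    \<comment> \<open>The first bound keeps the arc in the slice of \<open>h\<close>, the second, for \<open>q1 > 0\<close>,
      keeps it in the right half plane.\<close>
    define s0 where "s0 = (if 0 < q1 then min (\<alpha> / N \<tau>) (q1 / (d + 1)) else \<alpha> / N \<tau>)"
    have s0: "0 < s0" using \<alpha> N\<tau> cd by (simp add: s0_def)
    show ?thesis
    proof (rule edge_beyond_face[OF n hq h\<tau> Nq _ s0])
      show "\<exists>x y. w = x *\<^sub>R q + y *\<^sub>R \<tau>" for w
      proof -
        have "q1 * c + q2 * d = 1" using hq' by (simp add: algebra_simps)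
        then have "fst q * snd \<tau> \<noteq> snd q * fst \<tau>" by (auto simp: q_def \<tau>_def)
        then show ?thesis using plane_basis by metis
      qed
    next
      fix G assume G: "subordinate N G" and ne: "exposed_face N G \<noteq> {}"
        and sub: "exposed_face N G \<subseteq> {l *\<^sub>R (q + s *\<^sub>R \<tau>) | l s. 0 < l \<and> 0 < s \<and> s < s0}"
      obtain m n' where mn: "G = (m, n')" by fastforce
      have arc: "\<exists>l s. w = (l * (q1 - s * d), l * (q2 + s * c)) \<and> 0 < l \<and> 0 < s \<and> s < s0"
        if w_in: "w \<in> exposed_face N G" for w
      proof -
        obtain l s where "w = l *\<^sub>R (q + s *\<^sub>R \<tau>)" "0 < l" "0 < s" "s < s0" using sub w_in by blast
        then show ?thesis by (intro exI[of _ l] exI[of _ s]) (simp add: qs)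
      qed
      have slice: "1 - \<alpha> < (c, d) \<bullet> w" if w_in: "w \<in> exposed_face N G" for w
      proof -
        obtain l s where w: "w = l *\<^sub>R (q + s *\<^sub>R \<tau>)" "0 < l" "0 < s" "s < s0" using sub w_in by blast
        have "1 = l * N (q + s *\<^sub>R \<tau>)"
          using exposed_face_norm[OF G w_in] w is_norm_scaleR[OF n, of l "q + s *\<^sub>R \<tau>"] by simp
        also have "\<dots> \<le> l * (1 + s * N \<tau>)"
          using is_norm_triangle[OF n, of q "s *\<^sub>R \<tau>"] w Nq by (simp add: is_norm_scaleR[OF n])
        also have "\<dots> < l * (1 + \<alpha>)"
        proof -
          have "s < \<alpha> / N \<tau>" using w(4) by (auto simp: s0_def split: if_splits)
          then show ?thesis using N\<tau> w(2) by (simp add: field_simps)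
        qed
        finally have l: "1 < l * (1 + \<alpha>)" .
        have "1 - \<alpha> < l"
        proof (rule ccontr)
          assume "\<not> ?thesis"
          then have "l * (1 + \<alpha>) \<le> (1 - \<alpha>) * (1 + \<alpha>)" using \<alpha> by (intro mult_right_mono) auto
          also have "\<dots> = 1 - \<alpha> * \<alpha>" by (simp add: algebra_simps)
          also have "\<dots> \<le> 1" by simp
          finally show False using l by simp
        qed
        moreover have "(c, d) \<bullet> w = l"
          using w(1) hq h\<tau> by (simp only: inner_scaleR_right inner_add_right) simp
        ultimately show ?thesis by simp
      qed
      have snd_pos: "0 < snd w" if w_in: "w \<in> exposed_face N G" for w
      proof -
        obtain l s where w: "w = (l * (q1 - s * d), l * (q2 + s * c))" "0 < l" "0 < s"
          using arc[OF w_in] by blast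
        have "0 < q2 + s * c"
        proof (cases "c = 0")
          case True
          then have "d * q2 = 1" using hq' by simp
          then show ?thesis using q2 True by (cases "q2 = 0") auto
        next
          case False
          then show ?thesis using w q2 cd by (intro add_nonneg_pos) auto
        qed
        then show ?thesis using w by simp
      qed
      obtain w0 where w0: "w0 \<in> exposed_face N G" using ne by blast
      have n': "0 \<le> n'"
        using subordinate_sign_snd[OF N, of m n' "fst w0" "snd w0"] G w0 snd_pos[OF w0] mn
        by (simp add: zero_le_mult_iff)
      show "\<exists>w\<in>exposed_face N G. \<exists>t\<ge>0. N (q - t *\<^sub>R \<tau>) = 1 \<and> N (q - t *\<^sub>R \<tau> + w) = 2"
      proof (cases "0 < q1")
        case True
        have "0 < fst w0"
        proof -
          obtain l s where w: "w0 = (l * (q1 - s * d), l * (q2 + s * c))" "0 < l" "0 < s" "s < s0"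
            using arc[OF w0] by blast
          have "s < q1 / (d + 1)" using w True by (simp add: s0_def)
          then have "s * (d + 1) < q1" using cd by (simp add: field_simps)
          then have "s * d < q1" using w by (simp add: algebra_simps)
          then show ?thesis using w by simp
        qed
        then have "0 \<le> m"
          using subordinate_sign_fst[OF N, of m n' "fst w0" "snd w0"] G w0 mn
          by (simp add: zero_le_mult_iff)
        then obtain w where "w \<in> exposed_face N G" "N ((a, b) + w) = 2"
          using D n' G ne slice mn unfolding positively_Daugavet_def by blast
        moreover have "(a, b) = q - r *\<^sub>R \<tau>" by (simp add: q)
        ultimately show ?thesis using r ab by metis
      next
        case neg: False
        then have ca: "c * a = 0" using False ab cd by (metis mult_nonneg_nonneg not_le order_antisym)
        then have db: "d * b = 1" using h(2) by linarith
        then have d: "0 < d" using cd by (cases "d = 0") auto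
        have fst_neg: "fst w < 0" if w_in: "w \<in> exposed_face N G" for w
        proof -
          obtain l s where w: "w = (l * (q1 - s * d), l * (q2 + s * c))" "0 < l" "0 < s"
            using arc[OF w_in] by blast
          have "q1 - s * d < 0" using neg w d by (smt (verit) mult_pos_pos)
          then show ?thesis using w by (simp add: mult_pos_neg)
        qed
        have "m \<le> 0"
          using subordinate_sign_fst[OF N, of m n' "fst w0" "snd w0"] G w0 mn fst_neg[OF w0]
          by (simp add: zero_le_mult_iff)
        have refl: "(s, t) \<in> exposed_face N (- m, n') \<longleftrightarrow> (- s, t) \<in> exposed_face N G" for s t
          by (simp add: exposed_face_def unit_ball_def mn absolute_norm_reflect[OF N])
        have "1 - \<alpha> < (c, d) \<bullet> w" if "w \<in> exposed_face N (- m, n')" for w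
        proof -
          obtain s t where w: "w = (s, t)" by fastforce
          have *: "(- s, t) \<in> exposed_face N G" using that refl w by simp
          have "0 \<le> c * s" using fst_neg[OF *] cd by simp
          then show ?thesis using slice[OF *] w by simp
        qed
        moreover have "exposed_face N (- m, n') \<noteq> {}"
          using refl[of "- fst w0" "snd w0"] w0 by auto
        moreover have "subordinate N (- m, n')" using subordinate_reflect[OF N] G mn by blast
        ultimately obtain w where w: "w \<in> exposed_face N (- m, n')" "N ((a, b) + w) = 2"
          using D n' \<open>m \<le> 0\<close> unfolding positively_Daugavet_def by (metis neg_0_le_iff_le)
        obtain s t where st: "w = (s, t)" by fastforce
        have "(- s, t) \<in> exposed_face N G" using w refl st by simp
        moreover have "N ((- a, b) + (- s, t)) = 2"
          using w(2) st absolute_norm_reflect[OF N, of "a + s" "b + t"] by simp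
        moreover have "\<exists>t\<ge>0. (- a, b) = q - t *\<^sub>R \<tau>"
        proof (cases "a = 0")
          case True
          then have "(- a, b) = q - r *\<^sub>R \<tau>" by (simp add: q)
          then show ?thesis using r by blast
        next
          case False
          then have "c = 0" using ca by simp
          have refl_e: "(- a, b) = (a, b) + (2 * a / d) *\<^sub>R \<tau>" using d \<open>c = 0\<close> by (simp add: \<tau>_def)
          have "2 * a / d \<le> r"
            using r(3)[of "2 * a / d"] ab refl_e absolute_norm_reflect[OF N, of a b]
            by (metis less_irrefl not_le)
          moreover have "(- a, b) = q - (r - 2 * a / d) *\<^sub>R \<tau>"
            unfolding refl_e q by (simp add: algebra_simps)
          ultimately show ?thesis by (intro exI[of _ "r - 2 * a / d"]) simp
        qed
        ultimately show ?thesis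
          using ab absolute_norm_reflect[OF N, of a b] by metis
      qed
    qed
  qed
  then obtain s G where "0 < s" "subordinate N G" "G \<bullet> q = 1" "G \<bullet> (q + s *\<^sub>R \<tau>) = N (q + s *\<^sub>R \<tau>)" by blast
  moreover have "q + s *\<^sub>R \<tau> = (a - (r + s) * d, b + (r + s) * c)"
    by (simp add: qs q1_def q2_def algebra_simps)
  moreover have "(a, b) + s *\<^sub>R \<tau> = (a - s * d, b + s * c)" for s by (simp add: \<tau>_def)
  ultimately show ?thesis using that r by (simp add: q_def q1_def q2_def)
qed

text \<open>
  The other end of the face of \<open>(c, d)\<close> is reached by exchanging the coordinates.  If the face is a
  proper segment, it is itself one of the two sides at each of its ends; if it is just \<open>e\<close>, both
  sides at \<open>e\<close> come from outside.
\<close>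

lemma v_point_segment_if_positively_Daugavet:
  assumes N: "absolute_norm N" and nN: "normalized_norm N"
    and ab: "0 \<le> a" "0 \<le> b" "N (a, b) = 1" and cd: "0 \<le> c" "0 \<le> d"
    and h: "subordinate N (c, d)" "c * a + d * b = 1" and \<alpha>: "0 < \<alpha>"
    and D: "positively_Daugavet N (a, b) (c, d) \<alpha>"
  shows "\<exists>p q. v_point N p \<and> v_point N q \<and> (a, b) \<in> closed_segment p q"
proof -
  have n: "is_norm N" using N by (simp add: absolute_norm_def)
  define \<tau> where "\<tau> = (- d, c)"
  obtain r s G where r: "0 \<le> r" "N (a - r * d, b + r * c) = 1"
    "\<And>s. r < s \<Longrightarrow> 1 < N (a - s * d, b + s * c)"
    and s: "0 < s" and G: "subordinate N G" "G \<bullet> (a - r * d, b + r * c) = 1"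
    "G \<bullet> (a - (r + s) * d, b + (r + s) * c) = N (a - (r + s) * d, b + (r + s) * c)"
    using flat_edge_after_face[OF assms] by metis
  let ?M = "\<lambda>(s, t). N (t, s)"
  have M: "absolute_norm ?M" by (rule absolute_norm_swap[OF N])
  have face_swap: "exposed_face ?M (m, n) = prod.swap ` exposed_face N (n, m)" for m n
    by (auto simp: exposed_face_def unit_ball_def image_iff algebra_simps) 
  have nM: "normalized_norm ?M" using nN M by (simp add: normalized_norm_def absolute_norm_def)
  have subM: "subordinate ?M (d, c)" by (rule subordinate_swap[OF h(1)])
  have DM: "positively_Daugavet ?M (b, a) (d, c) \<alpha>"
    unfolding positively_Daugavet_def
  proof (intro allI impI)
    fix m n :: real assume mn: "0 \<le> m" "0 \<le> n" "subordinate ?M (m, n)" "exposed_face ?M (m, n) \<noteq> {}"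
      and sl: "\<forall>w\<in>exposed_face ?M (m, n). 1 - \<alpha> < (d, c) \<bullet> w"
    have "subordinate N (n, m)" using subordinate_swap[OF mn(3)] by simp
    moreover have "exposed_face N (n, m) \<noteq> {}" using mn(4) by (simp add: face_swap)
    moreover have "\<forall>w\<in>exposed_face N (n, m). 1 - \<alpha> < (c, d) \<bullet> w"
      using sl by (auto simp: face_swap algebra_simps)
    ultimately obtain w where "w \<in> exposed_face N (n, m)" "N ((a, b) + w) = 2"
      using D mn unfolding positively_Daugavet_def by blast
    then show "\<exists>w\<in>exposed_face ?M (m, n). ?M ((b, a) + w) = 2"
      by (intro bexI[of _ "prod.swap w"]) (auto simp: face_swap plus_prod_def)
  qed
  obtain r' s' H where r': "0 \<le> r'" "?M (b - r' * c, a + r' * d) = 1"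
    "\<And>s. r' < s \<Longrightarrow> 1 < ?M (b - s * c, a + s * d)"
    and s': "0 < s'" and H: "subordinate ?M H" "H \<bullet> (b - r' * c, a + r' * d) = 1"
    "H \<bullet> (b - (r' + s') * c, a + (r' + s') * d) = ?M (b - (r' + s') * c, a + (r' + s') * d)"
  proof (rule flat_edge_after_face[OF M nM ab(2,1) _ cd(2,1) subM _ \<alpha> DM])
    show "?M (b, a) = 1" "d * b + c * a = 1" using ab h by (simp_all add: add.commute)
  qed (rule that)
  obtain H1 H2 where "H = (H1, H2)" by fastforce
  define K where "K = (H2, H1)"
  have K: "subordinate N K" using subordinate_swap[of ?M H1 H2] H(1) by (simp add: K_def \<open>H = _\<close>)
  let ?e = "\<lambda>s. (a, b) + s *\<^sub>R \<tau>"
  have e: "?e s = (a - s * d, b + s * c)" for s by (simp add: \<tau>_def)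
  have R: "N (?e r) = 1" "\<And>s. r < s \<Longrightarrow> 1 < N (?e s)" "G \<bullet> ?e r = 1" "G \<bullet> ?e (r + s) = N (?e (r + s))"
    using r G by (simp_all only: e)
  have L: "N (?e (- r')) = 1" "\<And>s. r' < s \<Longrightarrow> 1 < N (?e (- s))"
      "K \<bullet> ?e (- r') = 1" "K \<bullet> ?e (- (r' + s')) = N (?e (- (r' + s')))"
    using r' H by (simp_all only: e) (simp_all add: K_def \<open>H = _\<close> algebra_simps)
  have hface: "(c, d) \<bullet> ?e x = 1" for x using h(2) by (simp add: \<tau>_def algebra_simps)
  have vI: "v_point N (?e x)"
    if "N (?e x) = 1" "z < x" "x < y" "0 < N (?e y)" "0 < N (?e z)"
      "subordinate N G" "G \<bullet> ?e x = 1" "G \<bullet> ?e y = N (?e y)"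
      "subordinate N H" "H \<bullet> ?e x = 1" "H \<bullet> ?e z = N (?e z)"
      "y - z < (x - z) * N (?e y) + (y - x) * N (?e z)" for x y z G H
  proof -
    have eq: "?e x + (y - x) *\<^sub>R \<tau> = ?e y" "?e x - (x - z) *\<^sub>R \<tau> = ?e z"
      by (simp_all add: algebra_simps)
    show ?thesis
      by (rule v_pointI[OF n that(1), of "y - x" "x - z" \<tau> G H];
          (unfold eq)?; (fact that | use that(2,3,12) in linarith))
  qed
  have v: "v_point N (?e r) \<and> v_point N (?e (- r'))"
  proof (cases "r + r' = 0")
    case True
    then have z: "r = 0" "r' = 0" using r r' by auto
    have g: "1 < N (?e s)" "1 < N (?e (- s'))" using R(2)[of s] L(2)[of s'] s s' z by (simp_all only: add_0)
    have "s' * 1 < s' * N (?e s)" "s * 1 < s * N (?e (- s'))"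
      by (intro mult_strict_left_mono g s s')+
    then have kink: "s - - s' < (0 - - s') * N (?e s) + (s - 0) * N (?e (- s'))" by simp
    have pos: "0 < N (?e s)" "0 < N (?e (- s'))" using g by linarith+
    have "v_point N (?e 0)"
      using vI[OF _ _ _ pos G(1) _ _ K _ _ kink] R L s s' z by (simp only: add_0 minus_zero neg_less_0_iff_less)
    then show ?thesis using z by simp
  next
    case False
    then have t: "0 < r + r'" using r r' by simp
    have g: "1 < N (?e (r + s))" "1 < N (?e (- (r' + s')))"
      using s s' by (intro R(2) L(2); simp)+
    then have pos: "0 < N (?e (r + s))" "0 < N (?e (- (r' + s')))" by linarith+
    have one: "0 < N (?e (- r'))" "0 < N (?e r)" unfolding R(1) L(1) by simp_all
    have h1: "(c, d) \<bullet> ?e r = N (?e r)" "(c, d) \<bullet> ?e (- r') = N (?e (- r'))"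
      unfolding hface R(1) L(1) by simp_all
    have "v_point N (?e r)"
    proof (rule vI[OF R(1) _ _ pos(1) one(1) G(1) R(3,4) h(1) hface h1(2)])
      show "r + s - - r' < (r - - r') * N (?e (r + s)) + (r + s - r) * N (?e (- r'))"
        using mult_strict_left_mono[OF g(1) t] unfolding L(1) by simp
    qed (use t s in auto)
    moreover have "v_point N (?e (- r'))"
    proof (rule vI[OF L(1) _ _ one(2) pos(2) h(1) hface h1(1) K L(3,4)])
      show "r - - (r' + s') < (- r' - - (r' + s')) * N (?e r) + (r - - r') * N (?e (- (r' + s')))"
        using mult_strict_left_mono[OF g(2) t] unfolding R(1) by simp
    qed (use t s' in auto)
    ultimately show ?thesis ..
  qed
  moreover have "(a, b) \<in> closed_segment (?e (- r')) (?e r)"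
  proof (cases "r + r' = 0")
    case True
    then have "r = 0" "r' = 0" using r(1) r'(1) by linarith+
    then show ?thesis by simp
  next
    case False
    define l where "l = r' / (r + r')"
    have l: "0 \<le> l" "l \<le> 1" "(1 - l) * (- r') + l * r = 0"
      using False r r' by (simp_all add: l_def field_simps)
    have "(1 - l) *\<^sub>R ?e (- r') + l *\<^sub>R ?e r = (a, b) + ((1 - l) * (- r') + l * r) *\<^sub>R \<tau>"
      by (simp only: scaleR_add_right scaleR_add_left scaleR_scaleR scaleR_diff_left scaleR_one) (simp add: algebra_simps)
    then show ?thesis using l by (auto simp: in_segment intro!: exI[of _ l])
  qed
  ultimately show ?thesis by blast
qed


section \<open>Relative Daugavet-points in terms of functionals\<close>

definition ball_sup :: "('z::real_vector \<Rightarrow> real) \<Rightarrow> ('z \<Rightarrow> real) \<Rightarrow> real" where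
  "ball_sup nrm f = (SUP v\<in>unit_ball nrm. f v)"

lemma slice_ball_sup: "slice nrm f \<alpha> = {w. nrm w \<le> 1 \<and> ball_sup nrm f - \<alpha> < f w}"
  by (simp add: slice_def ball_sup_def unit_ball_def)

lemma ball_sup_upper:
  assumes nrm: "is_norm nrm" and f: "f \<in> dual_space nrm" and "nrm w \<le> 1"
  shows "f w \<le> ball_sup nrm f"
proof -
  obtain K where K: "\<And>v. \<bar>f v\<bar> \<le> K * nrm v" using f by (auto simp: dual_space_def)
  have "f v \<le> \<bar>K\<bar>" if "nrm v \<le> 1" for v
  proof -
    have "K * nrm v \<le> \<bar>K\<bar> * 1"
      using that is_norm_nonneg[OF nrm, of v] by (intro mult_mono) auto
    then show ?thesis using K[of v] by simp
  qed
  then have "bdd_above (f ` unit_ball nrm)" by (intro bdd_aboveI2[of _ _ "\<bar>K\<bar>"]) (simp add: unit_ball_def)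
  then show ?thesis using assms(3) unfolding ball_sup_def by (intro cSUP_upper) (simp add: unit_ball_def)
qed

lemma ball_sup_nonneg:
  assumes nrm: "is_norm nrm" and f: "f \<in> dual_space nrm"
  shows "0 \<le> ball_sup nrm f"
proof -
  have "linear f" using f by (simp add: dual_space_def)
  then show ?thesis using ball_sup_upper[OF assms, of 0] by (simp add: is_norm_zero[OF nrm] linear_0)
qed

lemma le_ball_sup_times_norm:
  assumes nrm: "is_norm nrm" and f: "f \<in> dual_space nrm"
  shows "f w \<le> ball_sup nrm f * nrm w"
proof (cases "w = 0")
  case True
  then show ?thesis using f by (simp add: dual_space_def linear_0 is_norm_zero[OF nrm])
next
  case False
  then have pos: "0 < nrm w" by (rule is_norm_pos[OF nrm])
  have "linear f" using f by (simp add: dual_space_def)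
  have "f ((1 / nrm w) *\<^sub>R w) \<le> ball_sup nrm f"
    using pos by (intro ball_sup_upper[OF assms]) (simp add: is_norm_scaleR[OF nrm])
  then show ?thesis using pos by (simp add: linear_cmul[OF \<open>linear f\<close>] field_simps)
qed

lemma ball_sup_approx:
  assumes nrm: "is_norm nrm" and "0 < \<gamma>"
  obtains w where "nrm w \<le> 1" "ball_sup nrm f - \<gamma> < f w"
proof -
  have "\<exists>w. nrm w \<le> 1 \<and> ball_sup nrm f - \<gamma> < f w"
  proof (rule ccontr)
    assume "\<not> ?thesis"
    then have "f v \<le> ball_sup nrm f - \<gamma>" if "v \<in> unit_ball nrm" for v
      using that by (force simp: unit_ball_def)
    moreover have "unit_ball nrm \<noteq> {}"
      using is_norm_zero[OF nrm] by (auto simp: unit_ball_def intro!: exI[of _ 0])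
    ultimately have "(SUP v\<in>unit_ball nrm. f v) \<le> ball_sup nrm f - \<gamma>" by (intro cSUP_least)
    then show False using \<open>0 < \<gamma>\<close> by (simp add: ball_sup_def)
  qed
  then show ?thesis using that by blast
qed

lemma ball_sup_eqI:
  assumes "\<And>w. nrm w \<le> 1 \<Longrightarrow> f w \<le> M" and "\<And>\<gamma>. 0 < \<gamma> \<Longrightarrow> \<exists>w. nrm w \<le> 1 \<and> M - \<gamma> < f w"
  shows "ball_sup nrm f = M"
  unfolding ball_sup_def
proof (rule cSup_eq_non_empty)
  show "f ` unit_ball nrm \<noteq> {}" using assms(2)[of 1] by (auto simp: unit_ball_def)
  show "r \<le> M" if "r \<in> f ` unit_ball nrm" for r using that assms(1) by (auto simp: unit_ball_def)
  fix u assume u: "\<And>r. r \<in> f ` unit_ball nrm \<Longrightarrow> r \<le> u"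
  show "M \<le> u"
  proof (rule field_le_epsilon)
    fix \<gamma> :: real assume "0 < \<gamma>"
    then obtain w where "nrm w \<le> 1" "M - \<gamma> < f w" using assms(2) by blast
    then show "M \<le> u + \<gamma>" using u[of "f w"] by (force simp: unit_ball_def)
  qed
qed

lemma dual_space_if_le_norm:
  assumes nrm: "is_norm nrm" and f: "linear f" "\<And>v. f v \<le> nrm v"
  shows "f \<in> dual_space nrm" "\<bar>f v\<bar> \<le> nrm v"
proof -
  show *: "\<bar>f v\<bar> \<le> nrm v" for v
    using f(2)[of v] f(2)[of "- v"] by (simp add: linear_neg[OF f(1)] is_norm_minus[OF nrm])
  then show "f \<in> dual_space nrm" using f(1) by (auto simp: dual_space_def intro!: exI[of _ 1])
qed

text \<open>
  The condition that every slice inside the slice of \<open>f\<close> and \<open>\<alpha>\<close> has points almost at distance 2 from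
  \<open>z\<close>, without suprema over slices and for \<open>f\<close> of norm 1.
\<close>

definition far_in_slices :: "('z::real_vector \<Rightarrow> real) \<Rightarrow> 'z \<Rightarrow> ('z \<Rightarrow> real) \<Rightarrow> real \<Rightarrow> bool" where
  "far_in_slices nrm z f \<alpha> \<longleftrightarrow>
     (\<forall>\<phi>\<in>dual_space nrm. \<forall>\<beta>>0.
       (\<forall>w. nrm w \<le> 1 \<longrightarrow> ball_sup nrm \<phi> - \<beta> < \<phi> w \<longrightarrow> 1 - \<alpha> < f w) \<longrightarrow>
       (\<forall>\<epsilon>>0. \<exists>w. nrm w \<le> 1 \<and> ball_sup nrm \<phi> - \<beta> < \<phi> w \<and> 2 - \<epsilon> < nrm (z - w)))"

lemma relative_Daugavet_point_iff:
  assumes nrm: "is_norm nrm"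
  shows "relative_Daugavet_point nrm z \<longleftrightarrow>
    nrm z = 1 \<and> (\<exists>f \<alpha>. linear f \<and> (\<forall>v. f v \<le> nrm v) \<and> f z = 1 \<and> 0 < \<alpha> \<and> far_in_slices nrm z f \<alpha>)"
    (is "?L \<longleftrightarrow> ?R")
proof -
  have sup1: "ball_sup nrm f = 1" if "\<And>v. nrm v \<le> 1 \<Longrightarrow> f v \<le> 1" "nrm z = 1" "f z = 1" for f
    using that by (intro ball_sup_eqI) (auto intro!: exI[of _ z])
  have dist2: "nrm (z - w) \<le> 2" if "nrm z = 1" "nrm w \<le> 1" for w
    using is_norm_triangle[OF nrm, of z "- w"] that by (simp add: is_norm_minus[OF nrm])
  show ?thesis
  proof
    assume ?L
    then obtain S f \<alpha> where z: "nrm z = 1" and f: "f \<in> dual_space nrm" "dual_norm nrm f = 1" "f z = 1"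
      and \<alpha>: "0 < \<alpha>" and S: "S = slice nrm f \<alpha>"
      and T: "\<And>T. is_slice nrm T \<Longrightarrow> T \<subseteq> S \<Longrightarrow> (SUP w\<in>T. nrm (z - w)) = 2"
      by (auto simp: relative_Daugavet_point_def Daugavet_point_relative_to_def unit_sphere_def
          supporting_slice_def supporting_functionals_def)
    have "linear f" using f by (simp add: dual_space_def)
    obtain K where K: "\<And>v. \<bar>f v\<bar> \<le> K * nrm v" using f by (auto simp: dual_space_def)
    have "bdd_above ((\<lambda>v. \<bar>f v\<bar>) ` unit_ball nrm)"
    proof (rule bdd_aboveI2)
      fix v assume "v \<in> unit_ball nrm"
      then have "K * nrm v \<le> \<bar>K\<bar> * 1"
        using is_norm_nonneg[OF nrm, of v] by (intro mult_mono) (auto simp: unit_ball_def)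
      then show "\<bar>f v\<bar> \<le> \<bar>K\<bar>" using K[of v] by simp
    qed
    then have le1: "f v \<le> 1" if "nrm v \<le> 1" for v
      using cSUP_upper[of v "unit_ball nrm" "\<lambda>v. \<bar>f v\<bar>"] that f(2) by (auto simp: dual_norm_def unit_ball_def)
    have sup: "ball_sup nrm f = 1" using sup1 le1 z f(3) by blast
    have "far_in_slices nrm z f \<alpha>"
      unfolding far_in_slices_def
    proof (intro ballI allI impI)
      fix \<phi> \<beta> \<epsilon> assume \<phi>: "\<phi> \<in> dual_space nrm" and \<beta>: "(0::real) < \<beta>" and \<epsilon>: "(0::real) < \<epsilon>"
        and sub: "\<forall>w. nrm w \<le> 1 \<longrightarrow> ball_sup nrm \<phi> - \<beta> < \<phi> w \<longrightarrow> 1 - \<alpha> < f w"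
      let ?T = "slice nrm \<phi> \<beta>"
      have "(SUP w\<in>?T. nrm (z - w)) = 2"
        using \<phi> \<beta> sub by (intro T) (auto simp: is_slice_def S slice_ball_sup sup)
      moreover have "?T \<noteq> {}" using ball_sup_approx[OF nrm \<beta>] by (auto simp: slice_ball_sup)
      moreover have "bdd_above ((\<lambda>w. nrm (z - w)) ` ?T)"
        using dist2[OF z] by (intro bdd_aboveI2[of _ _ 2]) (simp add: slice_ball_sup)
      ultimately have "\<exists>w\<in>?T. 2 - \<epsilon> < nrm (z - w)" using \<epsilon> by (subst less_cSUP_iff[symmetric]) auto
      then show "\<exists>w. nrm w \<le> 1 \<and> ball_sup nrm \<phi> - \<beta> < \<phi> w \<and> 2 - \<epsilon> < nrm (z - w)"
        by (auto simp: slice_ball_sup)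
    qed
    moreover have "f v \<le> nrm v" for v using le_ball_sup_times_norm[OF nrm f(1), of v] sup by simp
    ultimately show ?R using z \<open>linear f\<close> f(3) \<alpha> by blast
  next
    assume ?R
    then obtain f \<alpha> where z: "nrm z = 1" and f: "linear f" "\<And>v. f v \<le> nrm v" "f z = 1"
      and \<alpha>: "0 < \<alpha>" and far: "far_in_slices nrm z f \<alpha>" by blast
    note dual = dual_space_if_le_norm[OF nrm f(1,2)]
    have sup: "ball_sup nrm f = 1" using f(2) z f(3) by (intro sup1) (auto intro: order_trans)
    have "dual_norm nrm f = 1"
      unfolding dual_norm_def
    proof (rule cSup_eq_maximum)
      show "1 \<in> (\<lambda>v. \<bar>f v\<bar>) ` unit_ball nrm"
        using z f(3) by (auto simp: unit_ball_def intro!: image_eqI[of _ _ z])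
      show "r \<le> 1" if "r \<in> (\<lambda>v. \<bar>f v\<bar>) ` unit_ball nrm" for r
        using that dual(2) by (auto simp: unit_ball_def intro: order_trans)
    qed
    then have "supporting_slice nrm z (slice nrm f \<alpha>)"
      using dual(1) f(3) \<alpha> by (auto simp: supporting_slice_def supporting_functionals_def)
    moreover have "(SUP w\<in>T. nrm (z - w)) = 2" if T: "is_slice nrm T" "T \<subseteq> slice nrm f \<alpha>" for T
    proof -
      obtain \<phi> \<beta> where \<phi>: "\<phi> \<in> dual_space nrm" and \<beta>: "0 < \<beta>" and Teq: "T = slice nrm \<phi> \<beta>"
        using T(1) by (auto simp: is_slice_def)
      have "\<forall>w. nrm w \<le> 1 \<longrightarrow> ball_sup nrm \<phi> - \<beta> < \<phi> w \<longrightarrow> 1 - \<alpha> < f w"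
        using T(2) by (auto simp: Teq slice_ball_sup sup)
      then have *: "\<exists>w\<in>T. 2 - \<epsilon> < nrm (z - w)" if "0 < \<epsilon>" for \<epsilon>
        using far \<phi> \<beta> that unfolding far_in_slices_def Teq slice_ball_sup by blast
      show ?thesis
      proof (rule cSup_eq_non_empty)
        show "(\<lambda>w. nrm (z - w)) ` T \<noteq> {}" using *[of 1] by auto
        show "r \<le> 2" if "r \<in> (\<lambda>w. nrm (z - w)) ` T" for r
          using that dist2[OF z] by (auto simp: Teq slice_ball_sup)
        fix u assume u: "\<And>r. r \<in> (\<lambda>w. nrm (z - w)) ` T \<Longrightarrow> r \<le> u"
        show "2 \<le> u"
        proof (rule field_le_epsilon)
          fix \<epsilon> :: real assume "0 < \<epsilon>"
          then obtain w where "w \<in> T" "2 - \<epsilon> < nrm (z - w)" using * by blast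
          then show "2 \<le> u + \<epsilon>" using u[of "nrm (z - w)"] by force
        qed
      qed
    qed
    ultimately show ?L
      using z unfolding relative_Daugavet_point_def Daugavet_point_relative_to_def unit_sphere_def by blast
  qed
qed

section \<open>Absolute sums\<close>

lemma is_norm_sum_norm:
  assumes N: "absolute_norm N"
  shows "is_norm (sum_norm N :: 'a::real_normed_vector \<times> 'b::real_normed_vector \<Rightarrow> real)"
proof -
  have n: "is_norm N" using N by (simp add: absolute_norm_def)
  show ?thesis
    unfolding is_norm_def
  proof (intro conjI allI)
    fix v w :: "'a \<times> 'b" and c :: real
    obtain v1 v2 where v: "v = (v1, v2)" by fastforce
    obtain w1 w2 where w: "w = (w1, w2)" by fastforce
    show "0 \<le> sum_norm N v" by (simp add: v sum_norm_def is_norm_nonneg[OF n])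
    have "N (norm v1, norm v2) = 0 \<longleftrightarrow> (norm v1, norm v2) = 0" using n unfolding is_norm_def by blast
    then show "sum_norm N v = 0 \<longleftrightarrow> v = 0" by (simp add: v sum_norm_def zero_prod_def)
    show "sum_norm N (c *\<^sub>R v) = \<bar>c\<bar> * sum_norm N v"
      using is_norm_scaleR[OF n, of "\<bar>c\<bar>" "(norm v1, norm v2)"] by (simp add: v sum_norm_def)
    have "N (norm (v1 + w1), norm (v2 + w2)) \<le> N (norm v1 + norm w1, norm v2 + norm w2)"
      by (rule absolute_norm_mono[OF N]) (simp_all add: norm_triangle_ineq)
    also have "\<dots> \<le> N (norm v1, norm v2) + N (norm w1, norm w2)"
      using is_norm_triangle[OF n, of "(norm v1, norm v2)" "(norm w1, norm w2)"] by simp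
    finally show "sum_norm N (v + w) \<le> sum_norm N v + sum_norm N w" by (simp add: v w sum_norm_def)
  qed
qed

lemma dual_space_sum_components:
  fixes \<Phi> :: "'a::real_normed_vector \<times> 'b::real_normed_vector \<Rightarrow> real"
  assumes N: "absolute_norm N" "normalized_norm N" and \<Phi>: "\<Phi> \<in> dual_space (sum_norm N)"
  shows "(\<lambda>w. \<Phi> (w, 0)) \<in> dual_space norm" "(\<lambda>v. \<Phi> (0, v)) \<in> dual_space norm"
    "\<Phi> (w, v) = \<Phi> (w, 0) + \<Phi> (0, v)"
proof -
  obtain K where lin: "linear \<Phi>" and K: "\<And>v. \<bar>\<Phi> v\<bar> \<le> K * sum_norm N v"
    using \<Phi> by (auto simp: dual_space_def)
  have "linear (\<Phi> \<circ> (\<lambda>w. (w, 0)))"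
    by (rule linear_compose[OF _ lin]) (auto intro: linearI)
  then have "linear (\<lambda>w. \<Phi> (w, 0))" by (simp add: comp_def)
  then show "(\<lambda>w. \<Phi> (w, 0)) \<in> dual_space norm"
    using K[of "(_, 0)"] by (auto simp: dual_space_def sum_norm_def absolute_normalized_bounds[OF N])
  have "linear (\<Phi> \<circ> (\<lambda>v. (0, v)))"
    by (rule linear_compose[OF _ lin]) (auto intro: linearI)
  then have "linear (\<lambda>v. \<Phi> (0, v))" by (simp add: comp_def)
  then show "(\<lambda>v. \<Phi> (0, v)) \<in> dual_space norm"
    using K[of "(0, _)"] by (auto simp: dual_space_def sum_norm_def absolute_normalized_bounds[OF N])
  show "\<Phi> (w, v) = \<Phi> (w, 0) + \<Phi> (0, v)" by (simp flip: linear_add[OF lin])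
qed

text \<open>
  This serves both summands.  The slice of \<open>\<phi>\<close> has to lie in the one of \<open>f\<close> only if \<open>c s > 0\<close>: for
  \<open>s = 0\<close> the distance from \<open>a x\<close> to 0 is \<open>a\<close> anyway, and for \<open>c = 0\<close> the distance has no weight.
\<close>

lemma far_point_in_slice:
  fixes x :: "'a::real_normed_vector"
  assumes far: "far_in_slices norm x f \<alpha>" and x: "norm x = 1" and \<phi>: "\<phi> \<in> dual_space norm"
    and pos: "0 < \<gamma>" "0 < \<epsilon>" and a: "0 \<le> a" "a \<le> 1" and s: "0 \<le> s" "s \<le> 1" and c: "0 \<le> c"
    and sub: "0 < c * s \<Longrightarrow> \<forall>w. norm w \<le> 1 \<longrightarrow> ball_sup norm \<phi> - \<gamma> < \<phi> w \<longrightarrow> 1 - \<alpha> < f w"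
  obtains w where "norm w \<le> 1" "ball_sup norm \<phi> - \<gamma> < \<phi> w"
    "c * (a + s - \<epsilon>) \<le> c * norm (a *\<^sub>R x - s *\<^sub>R w)"
proof (cases "0 < c * s")
  case True
  then obtain w where w: "norm w \<le> 1" "ball_sup norm \<phi> - \<gamma> < \<phi> w" "2 - \<epsilon> < norm (x - w)"
    using far \<phi> pos sub unfolding far_in_slices_def by blast
  have "norm (x - w) = norm ((a *\<^sub>R x - s *\<^sub>R w) + ((1 - a) *\<^sub>R x - (1 - s) *\<^sub>R w))"
    by (simp add: algebra_simps)
  also have "\<dots> \<le> norm (a *\<^sub>R x - s *\<^sub>R w) + (norm ((1 - a) *\<^sub>R x) + norm ((1 - s) *\<^sub>R w))"
    by (meson norm_triangle_ineq norm_triangle_ineq4 add_left_mono order_trans)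
  also have "norm ((1 - a) *\<^sub>R x) + norm ((1 - s) *\<^sub>R w) \<le> (1 - a) + (1 - s)"
    using a s x w mult_left_le[of "norm w" "1 - s"] by simp
  finally have "a + s - \<epsilon> \<le> norm (a *\<^sub>R x - s *\<^sub>R w)" using w by simp
  then show ?thesis using that w c by (meson mult_left_mono)
next
  case False
  obtain w where w: "norm w \<le> 1" "ball_sup norm \<phi> - \<gamma> < \<phi> w"
    using ball_sup_approx[OF is_norm_norm pos(1)] by blast
  have "c = 0 \<or> s = 0" using False c s by (auto simp: zero_less_mult_iff)
  then have "c * (a + s - \<epsilon>) \<le> c * norm (a *\<^sub>R x - s *\<^sub>R w)"
  proof
    assume "s = 0"
    then have "a + s - \<epsilon> \<le> norm (a *\<^sub>R x - s *\<^sub>R w)" using x a pos by simp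
    then show ?thesis using c by (rule mult_left_mono)
  qed simp
  then show ?thesis using that w by blast
qed

lemma linear_sum_functional:
  assumes "linear f" "linear g"
  shows "linear (\<lambda>(w, v). c * f w + d * g v :: real)"
  by (rule linearI)
    (auto simp: linear_add[OF assms(1)] linear_add[OF assms(2)]
      linear_cmul[OF assms(1)] linear_cmul[OF assms(2)] algebra_simps)

lemma sum_functional_le:
  assumes "subordinate N (c, d)" "0 \<le> c" "0 \<le> d" "\<And>w. f w \<le> norm w" "\<And>v. g v \<le> norm v"
  shows "c * f w + d * g v \<le> c * norm w + d * norm v" "c * norm w + d * norm v \<le> sum_norm N (w, v)"
proof -
  show "c * f w + d * g v \<le> c * norm w + d * norm v"
    using assms by (intro add_mono mult_left_mono) auto
  show "c * norm w + d * norm v \<le> sum_norm N (w, v)"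
    using subordinateD[OF assms(1), of "(norm w, norm v)"] by (simp add: sum_norm_def)
qed


text \<open>
  The functional \<open>(w, v) \<mapsto> c f(w) + d g(v)\<close> supports the point.  Every slice of the sum contains
  \<open>(s w, t v)\<close> for some \<open>(s, t)\<close> in the ball of the plane and all \<open>w\<close>, \<open>v\<close> in suitable slices of the
  balls of \<open>X\<close> and \<open>Y\<close>; the hypothesis on \<open>V\<close> makes \<open>(s, t)\<close> a point of the face of \<open>(c, d)\<close> if the
  slice is inside the supporting one.
\<close>

lemma relative_Daugavet_point_sumI:
  fixes x :: "'a::real_normed_vector" and y :: "'b::real_normed_vector"
  assumes N: "absolute_norm N" "normalized_norm N"
    and x: "norm x = 1" and f: "linear f" "\<And>v. f v \<le> norm v" "f x = 1"
    and \<alpha>x: "0 < \<alpha>x" and farx: "far_in_slices norm x f \<alpha>x"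
    and y: "norm y = 1" and g: "linear g" "\<And>v. g v \<le> norm v" "g y = 1"
    and \<alpha>y: "0 < \<alpha>y" and fary: "far_in_slices norm y g \<alpha>y"
    and ab: "0 \<le> a" "0 \<le> b" "N (a, b) = 1"
    and cd: "0 \<le> c" "0 \<le> d" and h: "subordinate N (c, d)" "c * a + d * b = 1"
    and V: "finite V" "\<And>s t. (s, t) \<in> V \<Longrightarrow> 0 \<le> s \<and> 0 \<le> t \<and> N (s, t) \<le> 1"
    and \<eta>: "0 < \<eta>"
    and dom: "\<And>w m n. N w \<le> 1 \<Longrightarrow> 0 \<le> m \<Longrightarrow> 0 \<le> n \<Longrightarrow>
      (c, d) \<bullet> w \<le> 1 - \<eta> \<or> (\<exists>v\<in>V. (m, n) \<bullet> w \<le> (m, n) \<bullet> v)"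
  shows "relative_Daugavet_point (sum_norm N) (a *\<^sub>R x, b *\<^sub>R y)"
proof -
  note nrm = is_norm_sum_norm[OF N(1), where 'a = 'a and 'b = 'b]
  note bounds = absolute_normalized_bounds[OF N]
  define F where "F = (\<lambda>(w, v). c * f w + d * g v)"
  have Fle: "F (w, v) \<le> sum_norm N (w, v)" for w v
    using sum_functional_le[OF h(1) cd, of f g w v] f g by (simp add: F_def) 
  have ev: "\<forall>\<^sub>F \<alpha> in at_right 0. 0 < k \<longrightarrow> \<alpha> \<le> k" for k :: real
    by (cases "0 < k") (auto intro: eventually_mono[OF eventually_at_right_real])
  \<comment> \<open>In this order the bounds put: points with \<open>h \<le> 1 - \<eta>\<close> outside the slice of \<open>F\<close>; the points of \<open>V\<close>
    outside it unless \<open>h = 1\<close> there; and the slices of \<open>\<phi>\<close> and \<open>\<psi>\<close> below inside those of \<open>f\<close> and \<open>g\<close>.\<close>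
  have "\<forall>\<^sub>F \<alpha> in at_right 0. 0 < \<alpha> \<and> (0 < \<eta> \<longrightarrow> \<alpha> \<le> \<eta>) \<and> (\<forall>v\<in>V.
      (0 < 1 - (c, d) \<bullet> v \<longrightarrow> \<alpha> \<le> 1 - (c, d) \<bullet> v) \<and>
      (0 < c * fst v * \<alpha>x \<longrightarrow> \<alpha> \<le> c * fst v * \<alpha>x) \<and>
      (0 < d * snd v * \<alpha>y \<longrightarrow> \<alpha> \<le> d * snd v * \<alpha>y))"
    by (intro eventually_conj ev eventually_ball_finite V(1) ballI eventually_at_right_less)
  then obtain \<alpha> where \<alpha>: "0 < \<alpha>" "0 < \<eta> \<longrightarrow> \<alpha> \<le> \<eta>" and \<alpha>V: "\<forall>v\<in>V.
      (0 < 1 - (c, d) \<bullet> v \<longrightarrow> \<alpha> \<le> 1 - (c, d) \<bullet> v) \<and>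
      (0 < c * fst v * \<alpha>x \<longrightarrow> \<alpha> \<le> c * fst v * \<alpha>x) \<and>
      (0 < d * snd v * \<alpha>y \<longrightarrow> \<alpha> \<le> d * snd v * \<alpha>y)"
    using eventually_happens'[OF trivial_limit_at_right_real] by blast
  have \<alpha>\<eta>: "\<alpha> \<le> \<eta>" using \<alpha>(2) \<eta> by blast
  have \<alpha>h: "\<alpha> \<le> 1 - (c * s + d * t)" if "(s, t) \<in> V" "c * s + d * t < 1" for s t
    using bspec[OF \<alpha>V that(1)] that(2) by simp
  have \<alpha>cs: "\<alpha> \<le> c * s * \<alpha>x" if "(s, t) \<in> V" "0 < c * s" for s t
    using bspec[OF \<alpha>V that(1)] mult_pos_pos[OF that(2) \<alpha>x] by simp
  have \<alpha>dt: "\<alpha> \<le> d * t * \<alpha>y" if "(s, t) \<in> V" "0 < d * t" for s t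
    using bspec[OF \<alpha>V that(1)] mult_pos_pos[OF that(2) \<alpha>y] by simp
  have "far_in_slices (sum_norm N) (a *\<^sub>R x, b *\<^sub>R y) F \<alpha>"
    unfolding far_in_slices_def
  proof (intro ballI allI impI)
    fix \<Phi> :: "'a \<times> 'b \<Rightarrow> real" and \<beta> \<epsilon> :: real
    assume \<Phi>: "\<Phi> \<in> dual_space (sum_norm N)" and \<beta>: "0 < \<beta>" and \<epsilon>: "0 < \<epsilon>"
      and sub: "\<forall>w. sum_norm N w \<le> 1 \<longrightarrow> ball_sup (sum_norm N) \<Phi> - \<beta> < \<Phi> w \<longrightarrow> 1 - \<alpha> < F w"
    define \<phi> where "\<phi> = (\<lambda>w. \<Phi> (w, 0))"
    define \<psi> where "\<psi> = (\<lambda>v. \<Phi> (0, v))"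
    have \<phi>: "\<phi> \<in> dual_space norm" and \<psi>: "\<psi> \<in> dual_space norm"
      and split: "\<And>w v. \<Phi> (w, v) = \<phi> w + \<psi> v"
      unfolding \<phi>_def \<psi>_def by (fact dual_space_sum_components[OF N \<Phi>])+
    have lin: "linear \<phi>" "linear \<psi>" using \<phi> \<psi> by (simp_all add: dual_space_def)
    let ?m = "ball_sup norm \<phi>" and ?n = "ball_sup norm \<psi>" and ?M = "ball_sup (sum_norm N) \<Phi>"
    note mn = ball_sup_nonneg[OF is_norm_norm \<phi>] ball_sup_nonneg[OF is_norm_norm \<psi>]
    define \<gamma> where "\<gamma> = \<beta> / 4"
    have \<gamma>: "0 < \<gamma>" using \<beta> by (simp add: \<gamma>_def)
    obtain s t where st: "0 \<le> s" "0 \<le> t" "N (s, t) \<le> 1" "?M - \<beta> / 2 < ?m * s + ?n * t"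
      and cases: "c * s + d * t \<le> 1 - \<alpha> \<or> (s, t) \<in> V \<and> c * s + d * t = 1"
    proof -
      obtain z where z: "sum_norm N z \<le> 1" "?M - \<beta> / 2 < \<Phi> z"
        using ball_sup_approx[OF nrm, of "\<beta> / 2" \<Phi>] \<beta> by auto
      obtain w v where "z = (w, v)" by fastforce
      then have wv: "N (norm w, norm v) \<le> 1" "?M - \<beta> / 2 < ?m * norm w + ?n * norm v"
        using z le_ball_sup_times_norm[OF is_norm_norm \<phi>, of w]
          le_ball_sup_times_norm[OF is_norm_norm \<psi>, of v] by (auto simp: sum_norm_def split)
      from dom[OF wv(1) mn] show ?thesis
      proof
        assume "(c, d) \<bullet> (norm w, norm v) \<le> 1 - \<eta>"
        then show ?thesis using that[of "norm w" "norm v"] wv \<alpha>\<eta> by simp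
      next
        assume "\<exists>v'\<in>V. (?m, ?n) \<bullet> (norm w, norm v) \<le> (?m, ?n) \<bullet> v'"
        then obtain s t where st: "(s, t) \<in> V" "?m * norm w + ?n * norm v \<le> ?m * s + ?n * t" by auto
        have "c * s + d * t \<le> 1" using subordinateD[OF h(1), of "(s, t)"] V(2)[OF st(1)] by simp
        then show ?thesis using that[of s t] V(2)[OF st(1)] wv st \<alpha>h[OF st(1)] by fastforce
      qed
    qed
    have st1: "s \<le> 1" "t \<le> 1" using bounds(1)[of s t] bounds(2)[of t s] st by linarith+
    have ab1: "a \<le> 1" "b \<le> 1" using bounds(1)[of a b] bounds(2)[of b a] ab by linarith+
    \<comment> \<open>The loss against \<open>?m * s + ?n * t\<close> is at most \<open>2 * \<gamma> = \<beta> / 2\<close>, as \<open>s\<close> and \<open>t\<close> are at most 1.\<close>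
    have mem: "sum_norm N (s *\<^sub>R w, t *\<^sub>R v) \<le> 1" "?M - \<beta> < \<Phi> (s *\<^sub>R w, t *\<^sub>R v)"
        "1 - \<alpha> < c * s * f w + d * t * g v"
      if w: "norm w \<le> 1" "?m - \<gamma> < \<phi> w" and v: "norm v \<le> 1" "?n - \<gamma> < \<psi> v" for w v
    proof -
      have "N (s * norm w, t * norm v) \<le> N (s, t)"
        using st w v by (intro absolute_norm_mono[OF N(1)]) (simp_all add: mult_left_le)
      then show 1: "sum_norm N (s *\<^sub>R w, t *\<^sub>R v) \<le> 1" using st by (simp add: sum_norm_def)
      have "s * (?m - \<gamma>) \<le> s * \<phi> w" "t * (?n - \<gamma>) \<le> t * \<psi> v"
        using st w v by (auto intro: mult_left_mono)
      moreover have "s * \<gamma> \<le> \<gamma>" "t * \<gamma> \<le> \<gamma>" using st1 \<gamma> by (simp_all add: mult_left_le_one_le st)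
      ultimately have "?m * s + ?n * t - 2 * \<gamma> \<le> s * \<phi> w + t * \<psi> v"
        by (simp add: algebra_simps)
      then show 2: "?M - \<beta> < \<Phi> (s *\<^sub>R w, t *\<^sub>R v)"
        using st(4) by (simp add: split linear_cmul[OF lin(1)] linear_cmul[OF lin(2)] \<gamma>_def)
      show "1 - \<alpha> < c * s * f w + d * t * g v"
        using sub[rule_format, OF 1 2]
        by (simp add: F_def linear_cmul[OF f(1)] linear_cmul[OF g(1)] mult.assoc)
    qed
    obtain w0 where w0: "norm w0 \<le> 1" "?m - \<gamma> < \<phi> w0" using ball_sup_approx[OF is_norm_norm \<gamma>] by blast
    obtain v0 where v0: "norm v0 \<le> 1" "?n - \<gamma> < \<psi> v0" using ball_sup_approx[OF is_norm_norm \<gamma>] by blast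
    have fle: "c * s * f w \<le> c * s" if "norm w \<le> 1" for w
      using f(2)[of w] that cd st by (intro mult_left_le) auto
    have gle: "d * t * g v \<le> d * t" if "norm v \<le> 1" for v
      using g(2)[of v] that cd st by (intro mult_left_le) auto
    have stV: "(s, t) \<in> V" "c * s + d * t = 1"
      using cases mem(3)[OF w0 v0] fle[OF w0(1)] gle[OF v0(1)] by auto
    have slicex: "\<forall>w. norm w \<le> 1 \<longrightarrow> ?m - \<gamma> < \<phi> w \<longrightarrow> 1 - \<alpha>x < f w" if cs: "0 < c * s"
    proof (intro allI impI)
      fix w assume w: "norm w \<le> 1" "?m - \<gamma> < \<phi> w"
      have "c * s * (1 - \<alpha>x) < c * s * f w"
        using mem(3)[OF w v0] gle[OF v0(1)] stV(2) \<alpha>cs[OF stV(1) cs] by (simp add: right_diff_distrib)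
      then show "1 - \<alpha>x < f w" using cs by (simp only: mult_less_cancel_left_pos)
    qed
    have slicey: "\<forall>v. norm v \<le> 1 \<longrightarrow> ?n - \<gamma> < \<psi> v \<longrightarrow> 1 - \<alpha>y < g v" if dt: "0 < d * t"
    proof (intro allI impI)
      fix v assume v: "norm v \<le> 1" "?n - \<gamma> < \<psi> v"
      have "d * t * (1 - \<alpha>y) < d * t * g v"
        using mem(3)[OF w0 v] fle[OF w0(1)] stV(2) \<alpha>dt[OF stV(1) dt] by (simp add: right_diff_distrib)
      then show "1 - \<alpha>y < g v" using dt by (simp only: mult_less_cancel_left_pos)
    qed
    have \<epsilon>4: "0 < \<epsilon> / 4" using \<epsilon> by simp
    obtain w where w: "norm w \<le> 1" "?m - \<gamma> < \<phi> w"
      and cw: "c * (a + s - \<epsilon> / 4) \<le> c * norm (a *\<^sub>R x - s *\<^sub>R w)"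
      using far_point_in_slice[OF farx x \<phi> \<gamma> \<epsilon>4 ab(1) ab1(1) st(1) st1(1) cd(1) slicex] by blast
    obtain v where v: "norm v \<le> 1" "?n - \<gamma> < \<psi> v"
      and dv: "d * (b + t - \<epsilon> / 4) \<le> d * norm (b *\<^sub>R y - t *\<^sub>R v)"
      using far_point_in_slice[OF fary y \<psi> \<gamma> \<epsilon>4 ab(2) ab1(2) st(2) st1(2) cd(2) slicey] by blast
    have "c \<le> 1" "d \<le> 1"
      using subordinateD[OF h(1), of "(1, 0)"] subordinateD[OF h(1), of "(0, 1)"] bounds(3)[of 1] bounds(4)[of 1]
      by simp_all
    then have "c * (\<epsilon> / 4) \<le> \<epsilon> / 4" "d * (\<epsilon> / 4) \<le> \<epsilon> / 4" using \<epsilon> by simp_all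
    moreover have "c * (a + s - \<epsilon> / 4) + d * (b + t - \<epsilon> / 4) = 2 - c * (\<epsilon> / 4) - d * (\<epsilon> / 4)"
    proof -
      have "c * (a + s - \<epsilon> / 4) + d * (b + t - \<epsilon> / 4)
          = (c * a + d * b) + (c * s + d * t) - c * (\<epsilon> / 4) - d * (\<epsilon> / 4)" by (simp only: algebra_simps)
      then show ?thesis unfolding h(2) stV(2) by simp
    qed
    moreover have "c * norm (a *\<^sub>R x - s *\<^sub>R w) + d * norm (b *\<^sub>R y - t *\<^sub>R v)
        \<le> sum_norm N ((a *\<^sub>R x, b *\<^sub>R y) - (s *\<^sub>R w, t *\<^sub>R v))"
      using subordinateD[OF h(1), of "(norm (a *\<^sub>R x - s *\<^sub>R w), norm (b *\<^sub>R y - t *\<^sub>R v))"]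
      by (simp add: sum_norm_def)
    ultimately have "2 - \<epsilon> < sum_norm N ((a *\<^sub>R x, b *\<^sub>R y) - (s *\<^sub>R w, t *\<^sub>R v))"
      using cw dv \<epsilon> by linarith
    then show "\<exists>z. sum_norm N z \<le> 1 \<and> ?M - \<beta> < \<Phi> z \<and> 2 - \<epsilon> < sum_norm N ((a *\<^sub>R x, b *\<^sub>R y) - z)"
      using mem[OF w v] by blast
  qed
  moreover have "linear F" unfolding F_def by (rule linear_sum_functional[OF f(1) g(1)])
  moreover have "F v \<le> sum_norm N v" for v using Fle by (cases v) simp
  moreover have "F (a *\<^sub>R x, b *\<^sub>R y) = 1"
    using h(2) f g by (simp add: F_def linear_cmul)
  moreover have "sum_norm N (a *\<^sub>R x, b *\<^sub>R y) = 1" using ab x y by (simp add: sum_norm_def)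
  ultimately show ?thesis using \<alpha>(1) unfolding relative_Daugavet_point_iff[OF nrm] by blast
qed

text \<open>
  The functional \<open>f\<close> is a substitute for \<open>\<phi> / \<parallel>\<phi>\<parallel>\<close> when \<open>\<phi> = 0\<close>.
\<close>

lemma norm_one_factor:
  fixes x :: "'a::real_normed_vector" and \<phi> :: "'a \<Rightarrow> real"
  assumes \<phi>: "\<phi> \<in> dual_space norm" and x: "norm x = 1" and f: "linear f" "\<And>v. f v \<le> norm v" "f x = 1"
  obtains \<phi>' where "linear \<phi>'" "\<And>w. \<phi>' w \<le> norm w" "\<And>w. \<phi> w = ball_sup norm \<phi> * \<phi>' w"
    "\<And>\<gamma>. 0 < \<gamma> \<Longrightarrow> \<exists>w. norm w \<le> 1 \<and> 1 - \<gamma> < \<phi>' w"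
proof (cases "ball_sup norm \<phi> = 0")
  case True
  have lin: "linear \<phi>" using \<phi> by (simp add: dual_space_def)
  have "\<phi> w = 0" for w
    using le_ball_sup_times_norm[OF is_norm_norm \<phi>, of w] le_ball_sup_times_norm[OF is_norm_norm \<phi>, of "- w"]
    by (simp add: True linear_neg[OF lin])
  moreover have "\<exists>w. norm w \<le> 1 \<and> 1 - \<gamma> < f w" if "0 < \<gamma>" for \<gamma>
    using f(3) x \<open>0 < \<gamma>\<close> by (intro exI[of _ x]) simp
  ultimately show ?thesis using that[of f] f True by simp
next
  case False
  have lin: "linear \<phi>" using \<phi> by (simp add: dual_space_def)
  let ?c = "ball_sup norm \<phi>"
  have c: "0 < ?c" using False ball_sup_nonneg[OF is_norm_norm \<phi>] by simp
  show ?thesis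
  proof (rule that[of "\<lambda>w. \<phi> w / ?c"])
    show "linear (\<lambda>w. \<phi> w / ?c)"
      by (rule linearI) (simp_all add: linear_add[OF lin] linear_cmul[OF lin] add_divide_distrib)
    show "\<phi> w / ?c \<le> norm w" for w
      using le_ball_sup_times_norm[OF is_norm_norm \<phi>, of w] c by (simp add: field_simps)
    show "\<phi> w = ?c * (\<phi> w / ?c)" for w using c by simp
    fix \<gamma> :: real assume "0 < \<gamma>"
    then have "0 < ?c * \<gamma>" using c by simp
    then obtain w where "norm w \<le> 1" "?c - ?c * \<gamma> < \<phi> w" using ball_sup_approx[OF is_norm_norm] by blast
    then show "\<exists>w. norm w \<le> 1 \<and> 1 - \<gamma> < \<phi> w / ?c"
      using c by (intro exI[of _ w]) (simp add: field_simps)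
  qed
qed

lemma compact_uniformly_negative:
  fixes \<phi> \<psi> :: "'x::topological_space \<Rightarrow> real"
  assumes "compact K" "continuous_on K \<phi>" "continuous_on K \<psi>" and neg: "\<And>w. w \<in> K \<Longrightarrow> \<phi> w < 0 \<or> \<psi> w < 0"
  obtains \<delta> where "0 < \<delta>" "\<And>w. w \<in> K \<Longrightarrow> \<phi> w \<le> - \<delta> \<or> \<psi> w \<le> - \<delta>"
proof (cases "K = {}")
  case False
  obtain w0 where w0: "w0 \<in> K" "\<And>w. w \<in> K \<Longrightarrow> min (\<phi> w) (\<psi> w) \<le> min (\<phi> w0) (\<psi> w0)"
    using continuous_attains_sup[OF assms(1) False continuous_on_min[OF assms(2,3)]] by blast
  show ?thesis
    by (rule that[of "- min (\<phi> w0) (\<psi> w0)"]) (use w0 neg in \<open>force simp: min_le_iff_disj min_less_iff_disj\<close>)+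
qed (use that[of 1] in auto)

lemma compact_unit_ball_plane:
  assumes N: "absolute_norm N" "normalized_norm N"
  shows "compact (unit_ball N)"
proof -
  have "closed (unit_ball N)"
    unfolding unit_ball_def using N(1)
    by (intro closed_Collect_le is_norm_continuous_on continuous_on_const) (simp add: absolute_norm_def)
  moreover have "unit_ball N \<subseteq> {-1..1} \<times> {-1..1}"
  proof clarify
    fix s t assume "(s, t) \<in> unit_ball N"
    then have "\<bar>s\<bar> \<le> 1" "\<bar>t\<bar> \<le> 1"
      using absolute_normalized_bounds(1,2)[OF N, where s = s and t = t] by (simp_all add: unit_ball_def)
    then show "s \<in> {-1..1} \<and> t \<in> {-1..1}" by (simp add: abs_le_iff)
  qed
  ultimately show ?thesis
    by (metis compact_Int_closed compact_Times compact_Icc inf.absorb_iff2)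
qed

text \<open>
  With \<open>f = c f'\<close> and \<open>g = d g'\<close> for \<open>f'\<close> and \<open>g'\<close> of norm 1, the map \<open>(w, v) \<mapsto> (f'(w), g'(v))\<close> sends
  the unit ball of the sum into the unit ball of the plane.  It pulls the slice of \<open>(c, d)\<close> back to the
  slice of \<open>F\<close>, and slices of \<open>(m, k)\<close> back to slices of the sum.  If all points \<open>w\<close> of the face of
  \<open>(m, k)\<close> had \<open>N (e + w) < 2\<close>, then by compactness this would hold with a uniform gap on a slice of
  \<open>(m, k)\<close>, and the pulled back slice would stay away from distance 2.
\<close>

lemma positively_Daugavet_if_sum:
  fixes x :: "'a::real_normed_vector" and y :: "'b::real_normed_vector"
  assumes N: "absolute_norm N" "normalized_norm N"
    and x: "norm x = 1" "linear fx" "\<And>v. fx v \<le> norm v" "fx x = 1"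
    and y: "norm y = 1" "linear gy" "\<And>v. gy v \<le> norm v" "gy y = 1"
    and ab: "0 \<le> a" "0 \<le> b" "N (a, b) = 1"
    and z: "relative_Daugavet_point (sum_norm N) (a *\<^sub>R x, b *\<^sub>R y)"
  obtains c d \<alpha> where "0 \<le> c" "0 \<le> d" "subordinate N (c, d)" "c * a + d * b = 1" "0 < \<alpha>"
    "positively_Daugavet N (a, b) (c, d) \<alpha>"
proof -
  have n: "is_norm N" using N by (simp add: absolute_norm_def)
  note nrm = is_norm_sum_norm[OF N(1), where 'a = 'a and 'b = 'b]
  let ?z = "(a *\<^sub>R x, b *\<^sub>R y)"
  obtain F \<alpha> where F: "linear F" "\<And>v. F v \<le> sum_norm N v" "F ?z = 1"
    and \<alpha>: "0 < \<alpha>" and far: "far_in_slices (sum_norm N) ?z F \<alpha>"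
    using z unfolding relative_Daugavet_point_iff[OF nrm] by blast
  define f where "f = (\<lambda>w. F (w, 0))"
  define g where "g = (\<lambda>v. F (0, v))"
  have f: "f \<in> dual_space norm" and g: "g \<in> dual_space norm" and Fsplit: "F (w, v) = f w + g v" for w v
    unfolding f_def g_def
    by (fact dual_space_sum_components[OF N dual_space_if_le_norm(1)[OF nrm F(1,2)]])+
  define c where "c = ball_sup norm f"
  define d where "d = ball_sup norm g"
  have cd: "0 \<le> c" "0 \<le> d"
    using ball_sup_nonneg[OF is_norm_norm f] ball_sup_nonneg[OF is_norm_norm g] by (simp_all add: c_def d_def)
  obtain f' where f': "linear f'" "\<And>w. f' w \<le> norm w" "\<And>w. f w = c * f' w"
    "\<And>\<gamma>. 0 < \<gamma> \<Longrightarrow> \<exists>w. norm w \<le> 1 \<and> 1 - \<gamma> < f' w"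
    using norm_one_factor[OF f x] unfolding c_def by blast
  obtain g' where g': "linear g'" "\<And>v. g' v \<le> norm v" "\<And>v. g v = d * g' v"
    "\<And>\<gamma>. 0 < \<gamma> \<Longrightarrow> \<exists>v. norm v \<le> 1 \<and> 1 - \<gamma> < g' v"
    using norm_one_factor[OF g y] unfolding d_def by blast
  \<comment> \<open>The norm of \<open>(m f', k g')\<close> is at least that of \<open>(m, k)\<close>.\<close>
  have almost: "\<exists>w v. sum_norm N (w, v) \<le> N (s, t) \<and> (1 - \<gamma>) * (m * \<bar>s\<bar> + k * \<bar>t\<bar>) \<le> m * f' w + k * g' v"
    if "0 \<le> m" "0 \<le> k" "0 < \<gamma>" for m k s t \<gamma>
  proof -
    obtain w where w: "norm w \<le> 1" "1 - \<gamma> < f' w" using f'(4) \<open>0 < \<gamma>\<close> by blast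
    obtain v where v: "norm v \<le> 1" "1 - \<gamma> < g' v" using g'(4) \<open>0 < \<gamma>\<close> by blast
    have "sum_norm N (\<bar>s\<bar> *\<^sub>R w, \<bar>t\<bar> *\<^sub>R v) \<le> N (s, t)"
      unfolding sum_norm_def using w v
      by simp (intro absolute_norm_mono[OF N(1)]; simp add: abs_mult mult_left_le)
    moreover have "(m * \<bar>s\<bar>) * (1 - \<gamma>) \<le> (m * \<bar>s\<bar>) * f' w" "(k * \<bar>t\<bar>) * (1 - \<gamma>) \<le> (k * \<bar>t\<bar>) * g' v"
      using that w v by (intro mult_left_mono; simp)+
    then have "(1 - \<gamma>) * (m * \<bar>s\<bar> + k * \<bar>t\<bar>) \<le> m * f' (\<bar>s\<bar> *\<^sub>R w) + k * g' (\<bar>t\<bar> *\<^sub>R v)"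
      by (simp add: linear_cmul[OF f'(1)] linear_cmul[OF g'(1)] algebra_simps)
    ultimately show ?thesis by blast
  qed
  have h: "subordinate N (c, d)"
    unfolding subordinate_def
  proof clarify
    fix s t :: real
    have "c * \<bar>s\<bar> + d * \<bar>t\<bar> \<le> N (s, t)"
    proof (rule field_le_epsilon)
      fix \<epsilon> :: real assume \<epsilon>: "0 < \<epsilon>"
      let ?S = "c * \<bar>s\<bar> + d * \<bar>t\<bar>"
      have S: "0 \<le> ?S" using cd by simp
      define \<gamma> where "\<gamma> = \<epsilon> / (?S + 1)"
      have \<gamma>: "0 < \<gamma>" "\<gamma> * ?S \<le> \<epsilon>" using \<epsilon> S by (auto simp: \<gamma>_def divide_simps intro!: mult_left_mono)
      obtain w v where "sum_norm N (w, v) \<le> N (s, t)" "(1 - \<gamma>) * ?S \<le> c * f' w + d * g' v"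
        using almost[OF cd \<gamma>(1)] by blast
      then have "(1 - \<gamma>) * ?S \<le> N (s, t)" using F(2)[of "(w, v)"] f'(3) g'(3) by (simp add: Fsplit)
      then show "?S \<le> N (s, t) + \<epsilon>" using \<gamma>(2) by (simp only: left_diff_distrib mult_1_left)
    qed
    moreover have "c * s \<le> c * \<bar>s\<bar>" "d * t \<le> d * \<bar>t\<bar>" using cd by (auto intro: mult_left_mono)
    ultimately show "(c, d) \<bullet> (s, t) \<le> N (s, t)" by simp
  qed
  have he: "c * a + d * b = 1"
  proof (rule order_antisym)
    show "c * a + d * b \<le> 1" using subordinateD[OF h, of "(a, b)"] ab by simp
    have "1 = (c * a) * f' x + (d * b) * g' y"
      using F(3) by (simp add: Fsplit f'(3) g'(3) linear_cmul[OF f'(1)] linear_cmul[OF g'(1)])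
    also have "\<dots> \<le> (c * a) * 1 + (d * b) * 1"
      using f'(2)[of x] g'(2)[of y] x y cd ab by (intro add_mono mult_left_mono) auto
    finally show "1 \<le> c * a + d * b" by simp
  qed
  have "positively_Daugavet N (a, b) (c, d) \<alpha>"
    unfolding positively_Daugavet_def
  proof (intro allI impI)
    fix m k :: real assume mk: "0 \<le> m" "0 \<le> k" and G: "subordinate N (m, k)"
      and ne: "exposed_face N (m, k) \<noteq> {}"
      and sl: "\<forall>w\<in>exposed_face N (m, k). 1 - \<alpha> < (c, d) \<bullet> w"
    show "\<exists>w\<in>exposed_face N (m, k). N ((a, b) + w) = 2"
    proof (rule ccontr)
      assume no: "\<not> ?thesis"
      have Gle: "(m, k) \<bullet> w \<le> 1" if "w \<in> unit_ball N" for w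
        using subordinateD[OF G, of w] that by (simp add: unit_ball_def)
      have cN: "continuous_on (unit_ball N) (\<lambda>w. N ((a, b) + w) - 2)"
        by (intro continuous_intros continuous_on_compose2[OF is_norm_continuous_on[OF n, of UNIV]]) auto
      have cG: "continuous_on (unit_ball N) (\<lambda>w. (m, k) \<bullet> w - 1)" by (intro continuous_intros)
      have ch: "continuous_on (unit_ball N) (\<lambda>w. 1 - \<alpha> - (c, d) \<bullet> w)" by (intro continuous_intros)
      have 1: "(m, k) \<bullet> w - 1 < 0 \<or> N ((a, b) + w) - 2 < 0" if w: "w \<in> unit_ball N" for w
      proof -
        have "N ((a, b) + w) \<le> 2"
          using is_norm_triangle[OF n, of "(a, b)" w] ab w by (simp add: unit_ball_def)
        moreover have "(m, k) \<bullet> w \<noteq> 1 \<or> N ((a, b) + w) \<noteq> 2" using no w unfolding exposed_face_def by blast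
        ultimately show ?thesis using Gle[OF w] by linarith
      qed
      have 2: "(m, k) \<bullet> w - 1 < 0 \<or> 1 - \<alpha> - (c, d) \<bullet> w < 0" if w: "w \<in> unit_ball N" for w
      proof -
        have "(m, k) \<bullet> w \<noteq> 1 \<or> 1 - \<alpha> < (c, d) \<bullet> w" using sl w unfolding exposed_face_def by blast
        then show ?thesis using Gle[OF w] by linarith
      qed
      obtain \<delta> where \<delta>: "0 < \<delta>" "\<And>w. w \<in> unit_ball N \<Longrightarrow> (m, k) \<bullet> w - 1 \<le> - \<delta> \<or> N ((a, b) + w) - 2 \<le> - \<delta>"
        using compact_uniformly_negative[OF compact_unit_ball_plane[OF N] cG cN 1] by blast
      obtain \<delta>' where \<delta>': "0 < \<delta>'" "\<And>w. w \<in> unit_ball N \<Longrightarrow> (m, k) \<bullet> w - 1 \<le> - \<delta>' \<or> 1 - \<alpha> - (c, d) \<bullet> w \<le> - \<delta>'"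
        using compact_uniformly_negative[OF compact_unit_ball_plane[OF N] cG ch 2] by blast
      define \<beta> where "\<beta> = min \<delta> \<delta>'"
      have \<beta>: "0 < \<beta>" "\<beta> \<le> \<delta>" "\<beta> \<le> \<delta>'" using \<delta>(1) \<delta>'(1) by (auto simp: \<beta>_def)
      define \<Phi> where "\<Phi> = (\<lambda>(w, v). m * f' w + k * g' v)"
      note Phi_le = sum_functional_le[OF G mk f'(2) g'(2)]
      have \<Phi>lin: "linear \<Phi>" unfolding \<Phi>_def by (rule linear_sum_functional[OF f'(1) g'(1)])
      have \<Phi>le: "\<Phi> u \<le> sum_norm N u" for u
        using Phi_le[of "fst u" "snd u"] by (cases u) (simp add: \<Phi>_def)
      have dual: "\<Phi> \<in> dual_space (sum_norm N)" by (rule dual_space_if_le_norm(1)[OF nrm \<Phi>lin \<Phi>le])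
      have sup: "ball_sup (sum_norm N) \<Phi> = 1"
      proof (rule ball_sup_eqI)
        show "\<Phi> u \<le> 1" if "sum_norm N u \<le> 1" for u using \<Phi>le[of u] that by simp
        fix \<gamma> :: real assume \<gamma>: "0 < \<gamma>"
        obtain s t where st: "(s, t) \<in> exposed_face N (m, k)" using ne by auto
        have "m * \<bar>s\<bar> + k * \<bar>t\<bar> \<le> N (s, t)"
          using subordinateD[OF G, of "(\<bar>s\<bar>, \<bar>t\<bar>)"] absolute_norm_abs[OF N(1)] by simp
        moreover have "m * s \<le> m * \<bar>s\<bar>" "k * t \<le> k * \<bar>t\<bar>" using mk by (auto intro: mult_left_mono)
        ultimately have one: "m * \<bar>s\<bar> + k * \<bar>t\<bar> = 1" using st by (simp add: exposed_face_def unit_ball_def)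
        obtain w v where "sum_norm N (w, v) \<le> N (s, t)"
          "(1 - \<gamma> / 2) * (m * \<bar>s\<bar> + k * \<bar>t\<bar>) \<le> m * f' w + k * g' v"
          using almost[OF mk, of "\<gamma> / 2"] \<gamma> by fastforce
        then have "sum_norm N (w, v) \<le> 1" "1 - \<gamma> < \<Phi> (w, v)"
          using st \<gamma> unfolding one by (simp_all add: \<Phi>_def exposed_face_def unit_ball_def)
        then show "\<exists>u. sum_norm N u \<le> 1 \<and> 1 - \<gamma> < \<Phi> u" by blast
      qed
      have "\<forall>u. sum_norm N u \<le> 1 \<longrightarrow> ball_sup (sum_norm N) \<Phi> - \<beta> < \<Phi> u \<longrightarrow> 1 - \<alpha> < F u"
      proof (intro allI impI)
        fix u assume u: "sum_norm N u \<le> 1" "ball_sup (sum_norm N) \<Phi> - \<beta> < \<Phi> u"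
        obtain w v where wv: "u = (w, v)" by fastforce
        have "\<bar>f' w\<bar> \<le> norm w" "\<bar>g' v\<bar> \<le> norm v"
          using dual_space_if_le_norm(2)[OF is_norm_norm] f' g' by blast+
        then have "N (f' w, g' v) \<le> N (norm w, norm v)"
          by (intro absolute_norm_mono[OF N(1)]) auto
        then have "(f' w, g' v) \<in> unit_ball N" using u by (simp add: wv sum_norm_def unit_ball_def)
        from \<delta>'(2)[OF this] show "1 - \<alpha> < F u"
          using u(2) \<beta> \<delta>'(1) unfolding sup by (auto simp: wv \<Phi>_def Fsplit f'(3) g'(3))
      qed
      then obtain u where u: "sum_norm N u \<le> 1" "1 - \<beta> < \<Phi> u" "2 - \<delta> < sum_norm N (?z - u)"
        using far dual \<beta>(1) \<delta>(1) unfolding far_in_slices_def sup[symmetric] by blast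
      obtain w v where wv: "u = (w, v)" by fastforce
      have "(norm w, norm v) \<in> unit_ball N" using u(1) by (simp add: wv sum_norm_def unit_ball_def)
      moreover have "1 - \<delta> < (m, k) \<bullet> (norm w, norm v)"
        using u(2) \<beta>(2) Phi_le(1)[of w v] by (simp add: wv \<Phi>_def)
      ultimately have "N (a + norm w, b + norm v) \<le> 2 - \<delta>" using \<delta>(2)[of "(norm w, norm v)"] by simp
      moreover have "sum_norm N (?z - u) \<le> N (a + norm w, b + norm v)"
      proof -
        have "norm (a *\<^sub>R x - w) \<le> a + norm w" "norm (b *\<^sub>R y - v) \<le> b + norm v"
          using norm_triangle_ineq4[of "a *\<^sub>R x" w] norm_triangle_ineq4[of "b *\<^sub>R y" v] ab x y by simp_all
        then show ?thesis
          unfolding wv sum_norm_def by simp (intro absolute_norm_mono[OF N(1)]; simp)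
      qed
      ultimately show False using u(3) by linarith
    qed
  qed
  then show ?thesis using that cd h he \<alpha> by blast
qed

theorem theorem3p34:
  fixes x :: "'a::banach" and y :: "'b::banach"
    and N :: "real \<times> real \<Rightarrow> real" and a b :: real
  assumes "relative_Daugavet_point norm x"
    and "relative_Daugavet_point norm y"
    and "absolute_norm N"
    and "normalized_norm N"
    and "0 \<le> a" and "0 \<le> b" and "N (a, b) = 1"
  shows "relative_Daugavet_point (sum_norm N) (a *\<^sub>R x, b *\<^sub>R y) \<longleftrightarrow>
    (\<exists>p q. v_point N p \<and> v_point N q \<and> (a, b) \<in> closed_segment p q)"
proof -
  note N = assms(3,4) and ab = assms(5-7)
  obtain f \<alpha>x where x: "norm x = 1" and f: "linear f" "\<And>v. f v \<le> norm v" "f x = 1"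
    and \<alpha>x: "0 < \<alpha>x" "far_in_slices norm x f \<alpha>x"
    using assms(1) unfolding relative_Daugavet_point_iff[OF is_norm_norm] by blast
  obtain g \<alpha>y where y: "norm y = 1" and g: "linear g" "\<And>v. g v \<le> norm v" "g y = 1"
    and \<alpha>y: "0 < \<alpha>y" "far_in_slices norm y g \<alpha>y"
    using assms(2) unfolding relative_Daugavet_point_iff[OF is_norm_norm] by blast
  show ?thesis
  proof
    assume "relative_Daugavet_point (sum_norm N) (a *\<^sub>R x, b *\<^sub>R y)"
    then obtain c d \<alpha> where "0 \<le> c" "0 \<le> d" "subordinate N (c, d)" "c * a + d * b = 1" "0 < \<alpha>"
      "positively_Daugavet N (a, b) (c, d) \<alpha>"
      by (rule positively_Daugavet_if_sum[OF N x f y g ab])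
    then show "\<exists>p q. v_point N p \<and> v_point N q \<and> (a, b) \<in> closed_segment p q"
      by (rule v_point_segment_if_positively_Daugavet[OF N ab])
  next
    assume "\<exists>p q. v_point N p \<and> v_point N q \<and> (a, b) \<in> closed_segment p q"
    then obtain p q where "v_point N p" "v_point N q" "(a, b) \<in> closed_segment p q" by blast
    then show "relative_Daugavet_point (sum_norm N) (a *\<^sub>R x, b *\<^sub>R y)"
      by (rule positive_slice_from_v_points[OF N(1) ab])
        (rule relative_Daugavet_point_sumI[OF N x f \<alpha>x y g \<alpha>y ab])
  qed
qed

end
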